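(* Let $c = 1-\frac{\log(e\log 2)}{\log 2}=0.086\ldots$. For Lebesgue-almost every $\alpha>0$ there is a constant $C=C(\alpha)>0$ such that $\delta_{\min}^{(\alpha)}(N)\ge C\,\frac{(\log N)^c}{N}$ for infinitely many integers $N$.
   Context: For irrational $\alpha>0$, the numbers $\alpha m^2+n^2$ with integers $m,n\ge 1$ are pairwise distinct; list them in increasing order as $0<\lambda_1<\lambda_2<\cdots$. For $N\ge 2$ define the minimal gap $\delta_{\min}^{(\alpha)}(N)=\min\{\lambda_{i+1}-\lambda_i : 1\le i<N\}$. *)

theory Defs
  imports "HOL-Analysis.Analysis"
begin

definition spec_set :: "real \<Rightarrow> real set" where
  "spec_set \<alpha> = {\<alpha> * (of_int m)^2 + (of_int n)^2 | m n :: int. m \<ge> 1 \<and> n \<ge> 1}"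

text \<open>lambda_i (i >= 1): the element of the set with exactly i - 1 smaller elements
  (i.e. the i-th smallest element; well defined for irrational alpha > 0).\<close>
definition lam :: "real \<Rightarrow> nat \<Rightarrow> real" where
  "lam \<alpha> i = (THE x. x \<in> spec_set \<alpha> \<and> card {y \<in> spec_set \<alpha>. y < x} = i - 1)"

definition delta_min :: "real \<Rightarrow> nat \<Rightarrow> real" where
  "delta_min \<alpha> N = Min {lam \<alpha> (i + 1) - lam \<alpha> i | i. 1 \<le> i \<and> i < N}"

end

theory Submission
  imports Defs "HOL-Number_Theory.Prime_Powers"
begin

text \<open>
  Let \<open>N = k\<^sup>2\<close>. The first \<open>N\<close> values are at most \<open>(\<alpha> + 1) k\<^sup>2\<close>, so a difference of two of them is
  either a positive integer or \<open>\<bar>\<alpha> a - b\<bar>\<close> with an integer \<open>b\<close> and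
  \<open>a = \<bar>m\<^sup>2 - m'\<^sup>2\<bar> = \<bar>m - m'\<bar> (m + m')\<close> an entry of a multiplication table of side \<open>M = O(k)\<close>.
  For fixed \<open>a\<close> the \<open>\<alpha>\<close> in a bounded interval with \<open>\<bar>\<alpha> a - b\<bar> < \<delta>\<close> for some \<open>b\<close> have measure
  \<open>O(\<delta>)\<close>. By Erdos, the table has only \<open>O(M\<^sup>2 / (ln M)\<^sup>c)\<close> distinct entries, so with
  \<open>\<delta> = C (ln N)\<^sup>c / N\<close> the exceptional \<open>\<alpha>\<close> have measure \<open>O(C)\<close> uniformly in \<open>k\<close>; hence so do the
  \<open>\<alpha>\<close> that are exceptional for all large \<open>k\<close>, and \<open>C \<rightarrow> 0\<close> leaves a null set.
\<close>

section \<open>Chebyshev's bound and logarithmic means\<close>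

text \<open>Both sides run over the pairs (m, d) with m * d \<le> x, grouped on the left by n = m *
  d and on the right by m.\<close>

lemma sum_divisors_swap:
  fixes g :: "nat \<Rightarrow> nat \<Rightarrow> 'a::comm_monoid_add"
  shows "(\<Sum>n=1..x. \<Sum>d | d dvd n. g d (n div d)) = (\<Sum>m=1..x. \<Sum>d=1..x div m. g d m)"
proof -
  have "(\<Sum>n=1..x. \<Sum>d | d dvd n. g d (n div d)) =
      (\<Sum>(n, d)\<in>(SIGMA n:{1..x}. {d. d dvd n}). g d (n div d))"
    by (rule sum.Sigma) auto
  also have "\<dots> = (\<Sum>(m, d)\<in>(SIGMA m:{1..x}. {1..x div m}). g d m)"
  proof (rule sum.reindex_bij_witness[of _ "\<lambda>(m, d). (m * d, d)" "\<lambda>(n, d). (n div d, d)"], goal_cases)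
    case (1 a)
    then show ?case by (auto dest: dvd_mult_div_cancel)
  next
    case (2 a)
    then obtain n d where a: "a = (n, d)" "1 \<le> n" "n \<le> x" "d dvd n" by auto
    then obtain m where m: "n = d * m" by (elim dvdE)
    with a have "d > 0" "m > 0" by auto
    with a m have "m \<le> x" by (metis le_trans mult_le_cancel2 mult_1 Suc_leI One_nat_def)
    moreover have "d \<le> x div m" using a m \<open>m > 0\<close> by (simp add: less_eq_div_iff_mult_less_eq)
    ultimately show ?case using a m \<open>d > 0\<close> \<open>m > 0\<close> by auto
  next
    case (3 a)
    then show ?case by auto
  next
    case (4 a)
    then show ?case by (auto simp: less_eq_div_iff_mult_less_eq mult.commute)
  next
    case (5 a)
    then show ?case by auto
  qed
  also have "\<dots> = (\<Sum>m=1..x. \<Sum>d=1..x div m. g d m)"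
    by (rule sum.Sigma[symmetric]) auto
  finally show ?thesis .
qed

text \<open>Legendre's formula in logarithmic form, from ln k being the divisor sum of
  \<open>mangoldt\<close>. The range ends at an arbitrary x \<ge> n, where the extra terms vanish,
  so that ln (2n)! and ln n! can be compared term by term.\<close>

lemma ln_fact_eq_sum_mangoldt:
  assumes "n \<le> x"
  shows "ln (fact n) = (\<Sum>d=1..x. (mangoldt d :: real) * real (n div d))"
proof -
  have "ln (fact n) = (\<Sum>k=1..n. ln (real k))"
    by (induction n) (auto simp: ln_mult)
  also have "\<dots> = (\<Sum>k=1..n. \<Sum>d | d dvd k. mangoldt (k div d))"
  proof (rule sum.cong)
    fix k assume "k \<in> {1..n}"
    then have "k > 0" by auto
    have "(\<Sum>d | d dvd k. mangoldt (k div d)) = (\<Sum>d | d dvd k. (mangoldt d :: real))"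
      using \<open>k > 0\<close>
      by (intro sum.reindex_bij_witness[of _ "\<lambda>d. k div d" "\<lambda>d. k div d"]) 
         (auto elim!: dvdE)
    then show "ln (real k) = (\<Sum>d | d dvd k. mangoldt (k div d))"
      using mangoldt_sum[of k, where ?'a = real] \<open>k > 0\<close> by simp
  qed auto
  also have "\<dots> = (\<Sum>m=1..n. \<Sum>d=1..n div m. mangoldt m)"
    by (rule sum_divisors_swap)
  also have "\<dots> = (\<Sum>m=1..n. mangoldt m * real (n div m))"
    by (simp add: mult.commute)
  also have "\<dots> = (\<Sum>m=1..x. mangoldt m * real (n div m))"
    using assms by (intro sum.mono_neutral_left) auto
  finally show ?thesis .
qed

text \<open>Chebyshev's argument: the weights floor(2n/d) - 2 floor(n/d) coming from the central
  binomial coefficient are nonnegative, and at least 1 for n < d \<le> 2n, while the coefficient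
  itself is at most 2^(2n).\<close>

lemma sum_mangoldt_double:
  "(\<Sum>d=1..2 * n. mangoldt d :: real) \<le> (\<Sum>d=1..n. mangoldt d) + 2 * real n"
proof -
  have "(\<Sum>d=1..2 * n. mangoldt d :: real) - (\<Sum>d=1..n. mangoldt d) = (\<Sum>d=n+1..2*n. mangoldt d)"
    using sum.ub_add_nat[of 1 n "mangoldt :: nat \<Rightarrow> real" n] by (simp add: mult_2)
  also have "\<dots> \<le> (\<Sum>d=n+1..2*n. mangoldt d * (real (2 * n div d) - 2 * real (n div d)))"
  proof (rule sum_mono)
    fix d assume d: "d \<in> {n+1..2*n}"
    then have "n div d = 0" "2 * n div d \<ge> 1"
      by (auto simp: less_eq_div_iff_mult_less_eq Suc_le_eq div_greater_zero_iff)
    then show "(mangoldt d :: real) \<le> mangoldt d * (real (2 * n div d) - 2 * real (n div d))"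
      using mangoldt_nonneg[of d] by (simp add: mult_le_cancel_left1)
  qed
  also have "\<dots> \<le> (\<Sum>d=1..2*n. mangoldt d * (real (2 * n div d) - 2 * real (n div d)))"
  proof (rule sum_mono2)
    fix d
    have "d * (2 * (n div d)) \<le> 2 * n" by (simp add: mult.left_commute)
    then have "2 * (n div d) \<le> 2 * n div d" 
      by (cases "d = 0") (auto simp: less_eq_div_iff_mult_less_eq mult.commute)
    then have "2 * real (n div d) \<le> real (2 * n div d)" by linarith
    then show "0 \<le> mangoldt d * (real (2 * n div d) - 2 * real (n div d))"
      by (intro mult_nonneg_nonneg mangoldt_nonneg) auto
  qed auto
  also have "\<dots> = ln (fact (2 * n)) - 2 * ln (fact n)"
    by (simp add: ln_fact_eq_sum_mangoldt[of n "2*n"] ln_fact_eq_sum_mangoldt[of "2*n" "2*n"]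
        sum_subtractf sum_distrib_left right_diff_distrib mult.left_commute)
  also have "\<dots> = ln (real ((2 * n) choose n))"
    by (simp add: binomial_fact ln_div ln_mult)
  also have "\<dots> \<le> ln (2 ^ (2 * n))"
  proof -
    have "(2 * n) choose n \<le> (\<Sum>k\<le>2*n. (2 * n) choose k)"
      by (rule member_le_sum) auto
    then have "(2 * n) choose n \<le> 2 ^ (2 * n)" by (simp only: choose_row_sum)
    then have "real ((2 * n) choose n) \<le> 2 ^ (2 * n)"
      by (metis of_nat_le_iff of_nat_numeral of_nat_power)
    then show ?thesis by (intro ln_mono) auto
  qed
  also have "\<dots> \<le> 2 * real n"
    using ln_2_less_1 by (simp add: ln_realpow mult_left_le)
  finally show ?thesis by simp
qed

text \<open>Repeated halving by \<open>sum_mangoldt_double\<close>; for odd n = 2m + 1 the one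
  additional term is at most 2m, which the constant 4 absorbs.\<close>

lemma sum_mangoldt_le: "(\<Sum>d=1..n. mangoldt d :: real) \<le> 4 * real n"
proof (induction n rule: less_induct)
  case (less n)
  consider "n = 0" | m where "n = 2 * m" "m > 0" | m where "n = 2 * m + 1"
    by (metis evenE oddE gr0I mult_0_right)
  then show ?case
  proof cases
    case 2
    with less.IH[of m] sum_mangoldt_double[of m] show ?thesis by simp
  next
    case (3 m)
    have "(mangoldt (2 * m + 1) :: real) \<le> ln (real (2 * m + 1))" by (intro mangoldt_le) auto
    also have "\<dots> \<le> 2 * real m" using ln_le_minus_one[of "real (2 * m + 1)"] by simp
    finally show ?thesis using 3 less.IH[of m] sum_mangoldt_double[of m] by simp
  qed simp
qed

text \<open>Expanding \<open>ln n\<close> as a divisor sum over von Mangoldt's function and applying Chebyshev's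
  bound trades the mean value of \<open>f\<close> for its logarithmic mean, at the gain of a factor \<open>ln x\<close>.\<close>
lemma ln_times_sum_le_log_mean:
  fixes f :: "nat \<Rightarrow> real"
  assumes nonneg: "\<And>n. f n \<ge> 0"
    and decr: "\<And>m d. m > 0 \<Longrightarrow> d > 0 \<Longrightarrow> f (m * d) \<le> f m"
  shows "ln (real x) * (\<Sum>n=1..x. f n) \<le> 5 * real x * (\<Sum>n=1..x. f n / real n)"
proof -
  have "(\<Sum>n=1..x. f n * ln (real n)) = (\<Sum>n=1..x. \<Sum>d | d dvd n. mangoldt d * f (n div d * d))"
  proof (rule sum.cong)
    fix n assume "n \<in> {1..x}"
    then have "(\<Sum>d | d dvd n. mangoldt d :: real) = ln (real n)"
      using mangoldt_sum[of n, where ?'a = real] by auto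
    moreover have "(\<Sum>d | d dvd n. mangoldt d * f (n div d * d)) = (\<Sum>d | d dvd n. mangoldt d * f n)"
      by (intro sum.cong) auto
    ultimately show "f n * ln (real n) = (\<Sum>d | d dvd n. mangoldt d * f (n div d * d))"
      by (simp add: sum_distrib_right[symmetric])
  qed auto
  also have "\<dots> = (\<Sum>m=1..x. \<Sum>d=1..x div m. mangoldt d * f (m * d))"
    by (rule sum_divisors_swap[of "\<lambda>d m. mangoldt d * f (m * d)"])
  also have "\<dots> \<le> (\<Sum>m=1..x. \<Sum>d=1..x div m. mangoldt d * f m)"
    by (intro sum_mono mult_left_mono decr mangoldt_nonneg) auto
  also have "\<dots> \<le> (\<Sum>m=1..x. 4 * real x * (f m / real m))"
  proof (rule sum_mono)
    fix m assume m: "m \<in> {1..x}"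
    have "(\<Sum>d=1..x div m. mangoldt d) \<le> 4 * real (x div m)" by (rule sum_mangoldt_le)
    also have "\<dots> \<le> 4 * (real x / real m)" using of_nat_div_le_of_nat[of x m, where ?'a = real] by simp
    finally have "(\<Sum>d=1..x div m. mangoldt d) * f m \<le> 4 * (real x / real m) * f m"
      by (intro mult_right_mono nonneg)
    then show "(\<Sum>d=1..x div m. mangoldt d * f m) \<le> 4 * real x * (f m / real m)"
      by (simp add: sum_distrib_right)
  qed
  finally have 1: "(\<Sum>n=1..x. f n * ln (real n)) \<le> 4 * real x * (\<Sum>n=1..x. f n / real n)"
    by (simp add: sum_distrib_left)
  \<comment> \<open>This is the amount by which ln n falls short of ln x. It costs one more copy of
    the logarithmic mean and turns the constant 4 into 5.\<close>
  have 2: "(\<Sum>n=1..x. f n * (ln (real x) - ln (real n))) \<le> (\<Sum>n=1..x. real x * (f n / real n))"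
  proof (rule sum_mono)
    fix n assume n: "n \<in> {1..x}"
    then have "ln (real x) - ln (real n) = ln (real x / real n)" by (simp add: ln_div)
    also have "\<dots> \<le> real x / real n - 1" using n by (intro ln_le_minus_one) auto
    finally have "ln (real x) - ln (real n) \<le> real x / real n" by simp
    then have "f n * (ln (real x) - ln (real n)) \<le> f n * (real x / real n)"
      by (intro mult_left_mono nonneg)
    then show "f n * (ln (real x) - ln (real n)) \<le> real x * (f n / real n)"
      by (simp add: mult.commute)
  qed
  have "ln (real x) * (\<Sum>n=1..x. f n) =
      (\<Sum>n=1..x. f n * ln (real n)) + (\<Sum>n=1..x. f n * (ln (real x) - ln (real n)))"
    by (simp add: sum.distrib[symmetric] sum_distrib_left algebra_simps)
  also have "\<dots> \<le> 4 * real x * (\<Sum>n=1..x. f n / real n) + real x * (\<Sum>n=1..x. f n / real n)"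
    using 1 2 by (simp add: sum_distrib_left)
  finally show ?thesis by (simp add: algebra_simps)
qed

section \<open>Euler products\<close>

lemma sum_multiples:
  fixes f :: "nat \<Rightarrow> 'a::comm_monoid_add"
  assumes "p > 0"
  shows "(\<Sum>n | n \<in> {1..x} \<and> p dvd n \<and> Q n. f n) = (\<Sum>m | m \<in> {1..x div p} \<and> Q (p * m). f (p * m))"
  using assms
  by (intro sum.reindex_bij_witness[of _ "\<lambda>m. p * m" "\<lambda>n. n div p"])
     (auto elim!: dvdE simp: less_eq_div_iff_mult_less_eq mult.commute Suc_le_eq)

lemma sum_split_multiples:
  fixes f :: "nat \<Rightarrow> 'a::comm_monoid_add"
  assumes "p > 0"
  shows "(\<Sum>n | n \<in> {1..x} \<and> Q n. f n) = (\<Sum>n | n \<in> {1..x} \<and> \<not> p dvd n \<and> Q n. f n) +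
           (\<Sum>m | m \<in> {1..x div p} \<and> Q (p * m). f (p * m))"
proof -
  have "{n. n \<in> {1..x} \<and> Q n} = {n. n \<in> {1..x} \<and> \<not> p dvd n \<and> Q n} \<union> {n. n \<in> {1..x} \<and> p dvd n \<and> Q n}"
    by auto
  then have "(\<Sum>n | n \<in> {1..x} \<and> Q n. f n) = (\<Sum>n | n \<in> {1..x} \<and> \<not> p dvd n \<and> Q n. f n) +
      (\<Sum>n | n \<in> {1..x} \<and> p dvd n \<and> Q n. f n)"
    by (simp only:) (rule sum.union_disjoint; auto)
  then show ?thesis by (simp only: sum_multiples[OF assms])
qed

text \<open>Splitting by divisibility by a new prime p gives A \<le> B + f p * A, where A is the sum
  with p adjoined and B the sum without it. Since f p < 1 this can be solved for A, which produces
  the new Euler factor.\<close>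

lemma sum_smooth_le_euler_product:
  fixes f :: "nat \<Rightarrow> real"
  assumes nonneg: "\<And>n. f n \<ge> 0" and one: "f 1 \<le> 1"
    and mult: "\<And>m n. m > 0 \<Longrightarrow> n > 0 \<Longrightarrow> f (m * n) = f m * f n"
    and less_1: "\<And>p. prime p \<Longrightarrow> f p < 1"
    and "finite P" and "\<And>p. p \<in> P \<Longrightarrow> prime p"
  shows "(\<Sum>n | n \<in> {1..x} \<and> prime_factors n \<subseteq> P. f n) \<le> (\<Prod>p\<in>P. 1 / (1 - f p))"
  using assms(5,6)
proof (induction P)
  case empty
  have "n = 1" if "prime_factors n \<subseteq> {}" "n \<ge> 1" for n :: nat
    using that by (auto simp: prime_factorization_empty_iff)
  then have "{n. n \<in> {1..x} \<and> prime_factors n \<subseteq> {}} \<subseteq> {1}" by auto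
  then have "(\<Sum>n | n \<in> {1..x} \<and> prime_factors n \<subseteq> {}. f n) \<le> (\<Sum>n\<in>{1}. f n)"
    using nonneg by (intro sum_mono2) auto
  then show ?case using one by simp
next
  case (insert p P)
  then have p: "prime p" "p > 0" by (auto simp: prime_gt_0_nat)
  let ?A = "\<lambda>y. \<Sum>n | n \<in> {1..y} \<and> prime_factors n \<subseteq> insert p P. f n"
  have pf: "prime_factors (p * m) \<subseteq> insert p P \<longleftrightarrow> prime_factors m \<subseteq> insert p P" if "m > 0" for m
    using that p by (auto simp: prime_factors_product prime_prime_factors)
  have "?A x = (\<Sum>n | n \<in> {1..x} \<and> \<not> p dvd n \<and> prime_factors n \<subseteq> insert p P. f n) +
      (\<Sum>m | m \<in> {1..x div p} \<and> prime_factors (p * m) \<subseteq> insert p P. f (p * m))"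
    by (rule sum_split_multiples) (use p in auto)
  also have "(\<Sum>m | m \<in> {1..x div p} \<and> prime_factors (p * m) \<subseteq> insert p P. f (p * m)) =
      f p * ?A (x div p)"
    unfolding sum_distrib_left
    by (intro sum.cong Collect_cong conj_cong refl pf mult) (use p in auto)
  finally have eq: "?A x = (\<Sum>n | n \<in> {1..x} \<and> \<not> p dvd n \<and> prime_factors n \<subseteq> insert p P. f n) +
      f p * ?A (x div p)" .
  have "(\<Sum>n | n \<in> {1..x} \<and> \<not> p dvd n \<and> prime_factors n \<subseteq> insert p P. f n) \<le>
      (\<Sum>n | n \<in> {1..x} \<and> prime_factors n \<subseteq> P. f n)"
    using nonneg by (intro sum_mono2) (auto simp: in_prime_factors_iff)
  moreover have "f p * ?A (x div p) \<le> f p * ?A x"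
    using nonneg div_le_dividend[of x p]
    by (intro mult_left_mono sum_mono2) (auto intro: order_trans)
  ultimately have "?A x \<le> (\<Sum>n | n \<in> {1..x} \<and> prime_factors n \<subseteq> P. f n) + f p * ?A x"
    using eq by linarith
  then have "(1 - f p) * ?A x \<le> (\<Prod>p\<in>P. 1 / (1 - f p))"
    using insert by (force simp: algebra_simps)
  then have "?A x \<le> (\<Prod>p\<in>P. 1 / (1 - f p)) / (1 - f p)"
    using less_1[OF p(1)] by (simp add: pos_le_divide_eq mult.commute)
  then show ?case using insert by simp
qed

lemma sum_le_euler_product:
  fixes f :: "nat \<Rightarrow> real"
  assumes nonneg: "\<And>n. f n \<ge> 0" and one: "f 1 \<le> 1"
    and mult: "\<And>m n. m > 0 \<Longrightarrow> n > 0 \<Longrightarrow> f (m * n) = f m * f n"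
    and less_1: "\<And>p. prime p \<Longrightarrow> f p < 1"
  shows "(\<Sum>n=1..x. f n) \<le> (\<Prod>p | prime p \<and> p \<le> x. 1 / (1 - f p))"
proof -
  have "{1..x} = {n. n \<in> {1..x} \<and> prime_factors n \<subseteq> {p. prime p \<and> p \<le> x}}"
    by (auto simp: in_prime_factors_iff dest!: dvd_imp_le)
  then have "(\<Sum>n=1..x. f n) = (\<Sum>n | n \<in> {1..x} \<and> prime_factors n \<subseteq> {p. prime p \<and> p \<le> x}. f n)"
    by (simp only:)
  also have "\<dots> \<le> (\<Prod>p | prime p \<and> p \<le> x. 1 / (1 - f p))"
    using assms by (intro sum_smooth_le_euler_product) auto
  finally show ?thesis .
qed

section \<open>The zeta series to the right of 1 and its Euler product\<close>

lemma prime_powr_neg_bounds: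
  fixes s :: real
  assumes "prime p" "s \<ge> 1"
  shows "real p powr (-s) > 0" "real p powr (-s) \<le> 1 / 2"
proof -
  have p: "p \<ge> 2" using assms by (simp add: prime_ge_2_nat)
  then show "real p powr (-s) > 0" by simp
  have "real p powr (-s) \<le> real p powr (-1)" using p assms by (intro powr_mono) auto
  also have "\<dots> \<le> 1 / 2" using p by (simp add: powr_minus_divide field_simps)
  finally show "real p powr (-s) \<le> 1 / 2" .
qed

text \<open>The right-hand side is the integral of t powr (-s) over [n, n + 1]; exp y \<ge> 1 + y
  takes the place of integration.\<close>

lemma powr_neg_telescope:
  fixes s :: real
  assumes "s > 1" "n > 0"
  shows "real (Suc n) powr (-s) \<le> (real n powr (1 - s) - real (Suc n) powr (1 - s)) / (s - 1)"
proof -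
  let ?m = "real (Suc n)"
  have "1 + (s - 1) / ?m \<le> 1 + (s - 1) * ln (?m / real n)"
  proof -
    have "ln (real n / ?m) \<le> real n / ?m - 1" using assms by (intro ln_le_minus_one) auto
    moreover have "ln (?m / real n) = - ln (real n / ?m)" using assms by (simp add: ln_div)
    moreover have "real n / ?m - 1 = - (1 / ?m)" by (simp add: field_simps)
    ultimately have "1 / ?m \<le> ln (?m / real n)" by linarith
    then have "(s - 1) * (1 / ?m) \<le> (s - 1) * ln (?m / real n)" 
      using assms by (intro mult_left_mono) auto
    then show ?thesis by simp
  qed
  also have "\<dots> \<le> exp ((s - 1) * ln (?m / real n))" by (rule exp_ge_add_one_self)
  also have "\<dots> = real n powr (1 - s) / ?m powr (1 - s)"
    using assms by (simp add: powr_def ln_div exp_diff[symmetric] algebra_simps)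
  finally have "?m powr (1 - s) * (1 + (s - 1) / ?m) \<le> real n powr (1 - s)"
    by (simp add: pos_le_divide_eq mult.commute)
  moreover have "?m powr (1 - s) * ((s - 1) / ?m) = (s - 1) * ?m powr (-s)"
    by (simp add: powr_diff powr_minus_divide)
  ultimately have "(s - 1) * ?m powr (-s) \<le> real n powr (1 - s) - ?m powr (1 - s)"
    by (simp add: distrib_left)
  then show ?thesis using assms by (simp add: pos_le_divide_eq mult.commute)
qed

lemma sum_powr_neg_le:
  fixes s :: real
  assumes "s > 1"
  shows "(\<Sum>n=1..N. real n powr (-s)) \<le> s / (s - 1)"
proof -
  have "(\<Sum>n=1..Suc N. real n powr (-s)) \<le> 1 + (1 - real (Suc N) powr (1 - s)) / (s - 1)" for N
  proof (induction N)
    case (Suc N)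
    then show ?case using powr_neg_telescope[of s "Suc N"] assms
      by (simp add: diff_divide_distrib)
  qed simp
  from this[of N] have "(\<Sum>n=1..Suc N. real n powr (-s)) \<le> 1 + 1 / (s - 1)"
    using assms by (smt (verit) divide_right_mono powr_ge_zero)
  moreover have "(\<Sum>n=1..N. real n powr (-s)) \<le> (\<Sum>n=1..Suc N. real n powr (-s))" by simp
  ultimately have "(\<Sum>n=1..N. real n powr (-s)) \<le> 1 + 1 / (s - 1)" by linarith
  also have "\<dots> = s / (s - 1)" using assms by (simp add: field_simps)
  finally show ?thesis .
qed

lemma powr_neg_summable_on:
  fixes s :: real
  assumes "s > 1" and "A \<subseteq> {1..}"
  shows "(\<lambda>n::nat. real n powr (-s)) summable_on A"
    and "(\<Sum>\<^sub>\<infinity>n\<in>A. real n powr (-s)) \<le> s / (s - 1)"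
proof -
  have *: "(\<Sum>n\<in>F. real n powr (-s)) \<le> s / (s - 1)" if "finite F" "F \<subseteq> A" for F
  proof -
    have "F \<subseteq> {1..Max F}" using that assms by (auto intro!: Max_ge)
    then have "(\<Sum>n\<in>F. real n powr (-s)) \<le> (\<Sum>n=1..Max F. real n powr (-s))"
      by (intro sum_mono2) auto
    also have "\<dots> \<le> s / (s - 1)" by (rule sum_powr_neg_le[OF assms(1)])
    finally show ?thesis .
  qed
  show 1: "(\<lambda>n::nat. real n powr (-s)) summable_on A"
    by (rule nonneg_bounded_partial_sums_imp_summable_on[where C = "s / (s - 1)"])
       (auto intro!: eventually_finite_subsets_at_top_weakI *)
  show "(\<Sum>\<^sub>\<infinity>n\<in>A. real n powr (-s)) \<le> s / (s - 1)"
    by (rule infsum_le_finite_sums[OF 1 *])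
qed

text \<open>Euler's sieve: removing the multiples of each p in P multiplies the zeta series by 1 - p
  powr (-s), and what remains still contains the term 1 for n = 1. Here the product is bounded from
  above, whereas in \<open>sum_le_euler_product\<close> it bounds a sum.\<close>

lemma zeta_euler_product_le:
  fixes s :: real
  assumes "s > 1" and "finite P" and "\<And>p::nat. p \<in> P \<Longrightarrow> prime p"
  shows "(\<Prod>p\<in>P. 1 / (1 - real p powr (-s))) \<le> s / (s - 1)"
proof -
  let ?h = "\<lambda>n::nat. real n powr (-s)"
  define A where "A Q = {n::nat. n \<ge> 1 \<and> (\<forall>p\<in>Q. \<not> p dvd n)}" for Q
  have summable: "?h summable_on B" if "B \<subseteq> A Q" for B Q
    using that by (intro powr_neg_summable_on assms) (auto simp: A_def)
  have less_1: "?h p < 1" if "prime p" for p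
    using that assms(1) prime_gt_1_nat[OF that] by (intro powr_less_one) auto
  have "infsum ?h (A P) = (\<Prod>p\<in>P. 1 - ?h p) * infsum ?h (A {})"
    using assms(2,3)
  proof (induction P)
    case (insert p P)
    then have p: "prime p" "p > 0" by (auto simp: prime_gt_0_nat)
    \<comment> \<open>Multiplication by p keeps \<open>A P\<close> because the elements of P are
      primes other than p. A truncated range would not be preserved, hence the infinite
      sums.\<close>
    have img: "{n \<in> A P. p dvd n} = (\<lambda>m. p * m) ` A P"
    proof (intro equalityI subsetI)
      fix n assume n: "n \<in> {n \<in> A P. p dvd n}"
      then obtain m where m: "n = p * m" by (auto elim: dvdE)
      with n have "m \<in> A P" by (auto simp: A_def Suc_le_eq)
      with m show "n \<in> (\<lambda>m. p * m) ` A P" by auto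
    next
      fix n assume "n \<in> (\<lambda>m. p * m) ` A P"
      then obtain m where m: "n = p * m" "m \<in> A P" by auto
      have "\<not> q dvd n" if q: "q \<in> P" for q
      proof -
        have "prime q" "q \<noteq> p" using q insert by auto
        then have "\<not> q dvd p" using p primes_dvd_imp_eq by blast
        then show ?thesis using m q \<open>prime q\<close> by (auto simp: A_def prime_dvd_mult_iff)
      qed
      with m p show "n \<in> {n \<in> A P. p dvd n}" by (auto simp: A_def Suc_le_eq)
    qed
    have "A (insert p P) = A P - {n \<in> A P. p dvd n}" by (auto simp: A_def)
    then have "infsum ?h (A (insert p P)) = infsum ?h (A P) - infsum ?h {n \<in> A P. p dvd n}"
      by (simp only:) (intro infsum_Diff summable[of _ P]; auto)
    also have "infsum ?h {n \<in> A P. p dvd n} = infsum (?h \<circ> (\<lambda>m. p * m)) (A P)"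
      unfolding img using p by (intro infsum_reindex) (auto simp: inj_on_def)
    also have "\<dots> = ?h p * infsum ?h (A P)"
      by (simp add: o_def powr_mult infsum_cmult_right')
    finally show ?case using insert by (simp add: algebra_simps)
  qed simp
  moreover have "infsum ?h (A P) \<ge> infsum ?h {1}"
  proof (rule infsum_mono2)
    have "1 \<in> A P" using assms(3)[of 1] by (auto simp: A_def)
    then show "{1} \<subseteq> A P" by simp
  qed (auto intro: summable[of _ P])
  ultimately have "1 \<le> (\<Prod>p\<in>P. 1 - ?h p) * infsum ?h (A {})" by simp
  also have "\<dots> \<le> (\<Prod>p\<in>P. 1 - ?h p) * (s / (s - 1))"
    using assms less_1 by (intro mult_left_mono powr_neg_summable_on prod_nonneg)
      (auto simp: A_def less_imp_le)
  finally have "1 / (\<Prod>p\<in>P. 1 - ?h p) \<le> s / (s - 1)"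
    using assms less_1 by (subst pos_divide_le_eq) (auto intro!: prod_pos simp: mult.commute)
  then show ?thesis by (simp add: prod_dividef)
qed

text \<open>Adjoining p costs the factor (1 - t) / (1 - z * t) with t = p powr (-s), the local ratio
  of the Dirichlet series of the weight to zeta. Dividing by zeta saves the logarithm that a direct
  application of Rankin's trick would lose. The induction is for all x at once since the recursion
  passes to x div p; z < 2 keeps z * t below 1.\<close>

lemma sum_prime_weights_le:
  fixes s z :: real
  assumes "s \<ge> 1" "1 \<le> z" "z < 2" and "finite P" and "\<And>p::nat. p \<in> P \<Longrightarrow> prime p"
  shows "(\<Sum>n=1..x. \<Prod>p\<in>P. z ^ multiplicity p n) \<le>
     real x powr s * (\<Prod>p\<in>P. (1 - real p powr (-s)) / (1 - z * real p powr (-s)))"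
  using assms(4,5)
proof (induction P arbitrary: x)
  case empty
  show ?case
  proof (cases "x = 0")
    case False
    then have "real x powr 1 \<le> real x powr s" using assms by (intro powr_mono) auto
    then show ?thesis by simp
  qed simp
next
  case (insert p P)
  then have p: "prime p" "p \<ge> 2" by (auto simp: prime_ge_2_nat)
  let ?g = "\<lambda>Q n. \<Prod>p\<in>Q. z ^ multiplicity p n"
  let ?S = "\<lambda>Q x. \<Sum>n=1..x. ?g Q n"
  define t where "t = real p powr (-s)"
  define D where "D = (\<Prod>p\<in>P. (1 - real p powr (-s)) / (1 - z * real p powr (-s)))"
  have IH: "?S P y \<le> real y powr s * D" for y
    using insert unfolding D_def by auto
  have D: "D \<ge> 0" using IH[of 1] prod_nonneg[of P "\<lambda>q. z ^ multiplicity q 1"] assms by simp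
  have t: "t \<le> 1 / 2" "t > 0"
    unfolding t_def using prime_powr_neg_bounds[OF p(1)] assms by auto
  have zt: "z * t < 1"
    using mult_left_mono[of t "1/2" z] t assms by linarith
  have g1: "?g (insert p P) n = z ^ multiplicity p n * ?g P n" for n using insert by simp
  have g2: "?g P (p * n) = ?g P n" if "n > 0" for n
  proof (rule prod.cong)
    fix q assume "q \<in> P"
    then have "prime q" "q \<noteq> p" using insert by auto
    then have "multiplicity q p = 0" using p by (simp add: prime_multiplicity_other)
    then show "z ^ multiplicity q (p * n) = z ^ multiplicity q n"
      using that p \<open>prime q\<close> by (simp add: prime_elem_multiplicity_mult_distrib)
  qed auto
  have split: "(\<Sum>n=1..y. h n) = (\<Sum>n | n \<in> {1..y} \<and> \<not> p dvd n. h n) + (\<Sum>m=1..y div p. h (p * m))" for h :: "nat \<Rightarrow> real" and y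
    using sum_split_multiples[of p h y "\<lambda>_. True"] p
    by (simp only: simp_thms Collect_mem_eq prime_gt_0_nat)
  \<comment> \<open>Integers prime to p have the same weight for P and for \<open>insert p P\<close>
    and cancel in the difference; a multiple p * m gains a factor z over m.\<close>
  have rec: "?S (insert p P) y - ?S P y =
      z * (?S (insert p P) (y div p) - ?S P (y div p)) + (z - 1) * ?S P (y div p)" for y
  proof -
    have "(\<Sum>n | n \<in> {1..y} \<and> \<not> p dvd n. ?g (insert p P) n) = (\<Sum>n | n \<in> {1..y} \<and> \<not> p dvd n. ?g P n)"
      by (intro sum.cong) (auto simp: g1 not_dvd_imp_multiplicity_0)
    moreover have "(\<Sum>m=1..y div p. ?g (insert p P) (p * m)) = z * ?S (insert p P) (y div p)"
      unfolding sum_distrib_left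
      using p by (intro sum.cong)
        (auto simp: g1 g2 prime_elem_multiplicity_mult_distrib multiplicity_prime)
    moreover have "(\<Sum>m=1..y div p. ?g P (p * m)) = ?S P (y div p)"
      by (intro sum.cong) (auto simp: g2)
    ultimately show ?thesis
      unfolding split[of "?g (insert p P)" y] split[of "?g P" y] by (simp add: algebra_simps)
  qed
  \<comment> \<open>The constant \<open>e\<close> is the fixed point of \<open>e = z e t + (z - 1) t\<close>.\<close>
  define e where "e = (z - 1) * t / (1 - z * t)"
  have e: "e \<ge> 0" using assms t zt by (simp add: e_def)
  have "z * t * e + (z - 1) * t = e" using zt by (simp add: e_def field_simps)
  then have e_eq: "z * (e * D * (t * Y)) + (z - 1) * (t * Y * D) = e * D * Y" for Y
    by (metis (no_types, opaque_lifting) distrib_right mult.assoc mult.commute)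
  \<comment> \<open>The increment is bounded instead of the sum itself. Both coefficients in
    \<open>rec\<close> are nonnegative because z \<ge> 1, and passing from y to y div p gains the
    factor t, so the fixed point \<open>e\<close> closes the induction.\<close>
  have diff: "?S (insert p P) y - ?S P y \<le> e * D * real y powr s" for y
  proof (induction y rule: less_induct)
    case (less y)
    show ?case
    proof (cases "y = 0")
      case False
      have "real (y div p) powr s \<le> (real y / real p) powr s"
        using of_nat_div_le_of_nat[of y p, where ?'a = real] assms by (intro powr_mono2) auto
      also have "\<dots> = t * real y powr s" by (simp add: t_def powr_divide powr_minus_divide)
      finally have le: "real (y div p) powr s \<le> t * real y powr s" .
      have "?S (insert p P) y - ?S P y =
          z * (?S (insert p P) (y div p) - ?S P (y div p)) + (z - 1) * ?S P (y div p)"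
        by (rule rec)
      also have "\<dots> \<le> z * (e * D * real (y div p) powr s) + (z - 1) * (real (y div p) powr s * D)"
        using less.IH[of "y div p"] False p IH[of "y div p"] assms
        by (intro add_mono mult_left_mono) auto
      also have "\<dots> \<le> z * (e * D * (t * real y powr s)) + (z - 1) * (t * real y powr s * D)"
        using le e D assms by (intro add_mono mult_left_mono mult_right_mono) auto
      also have "\<dots> = e * D * real y powr s" by (rule e_eq)
      finally show ?thesis .
    qed simp
  qed
  have "?S (insert p P) x \<le> ?S P x + e * D * real x powr s" using diff[of x] by simp
  also have "\<dots> \<le> real x powr s * D + e * D * real x powr s" using IH[of x] by simp
  also have "\<dots> = real x powr s * ((1 + e) * D)" by (simp add: algebra_simps)
  also have "1 + e = (1 - t) / (1 - z * t)" using zt by (simp add: e_def field_simps)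
  finally show ?case using insert by (simp add: t_def D_def)
qed

section \<open>Mean values of \<open>z ^ bigomega n\<close> and the multiplication table\<close>

definition bigomega :: "nat \<Rightarrow> nat" where
  "bigomega n = size (prime_factorization n)"

lemma bigomega_1 [simp]: "bigomega 1 = 0" "bigomega (Suc 0) = 0"
  by (simp_all add: bigomega_def)

lemma bigomega_mult: "m > 0 \<Longrightarrow> n > 0 \<Longrightarrow> bigomega (m * n) = bigomega m + bigomega n"
  by (simp add: bigomega_def prime_factorization_mult)

lemma bigomega_prime: "prime p \<Longrightarrow> bigomega p = 1"
  by (simp add: bigomega_def prime_factorization_prime)

lemma power_bigomega_eq_prod:
  fixes z :: "'a::comm_semiring_1"
  assumes "n \<in> {1..x}"
  shows "z ^ bigomega n = (\<Prod>p | prime p \<and> p \<le> x. z ^ multiplicity p n)"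
proof -
  have "z ^ bigomega n = (\<Prod>p\<in>prime_factors n. z ^ multiplicity p n)"
    unfolding bigomega_def size_multiset_overloaded_eq
    by (simp add: power_sum count_prime_factorization in_prime_factors_iff cong: prod.cong_simp)
  also have "\<dots> = (\<Prod>p | prime p \<and> p \<le> x. z ^ multiplicity p n)"
    using assms
    by (intro prod.mono_neutral_left)
       (auto simp: in_prime_factors_iff not_dvd_imp_multiplicity_0 dest!: dvd_imp_le)
  finally show ?thesis .
qed

text \<open>Weighted AM-GM for 1 - t and 1 with weights w and 1 - w.\<close>

lemma Bernoulli_powr:
  fixes t w :: real
  assumes "0 \<le> w" "w \<le> 1" "0 \<le> t" "t < 1"
  shows "(1 - t) powr w \<le> 1 - w * t"
  using Youngs_inequality_0[of w "1 - w" "1 - t" 1] assms by (simp add: algebra_simps)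

text \<open>With t = p powr (-s), the local factor is compared with the power z - 1 of the factor of
  zeta(s). Bernoulli's inequality leaves a discrepancy of second order in t, which is absorbed by
  the squared factor of zeta(2 s), whose product over the primes stays bounded.\<close>

lemma euler_factor_le:
  fixes t z :: real
  assumes "1 \<le> z" "z \<le> 3/2" "0 < t" "t \<le> 1/2"
  shows "(1 - t) / (1 - z * t) \<le> (1 / (1 - t)) powr (z - 1) * (1 / (1 - t\<^sup>2))\<^sup>2"
proof -
  have zt: "z * t \<le> 3/2 * (1/2)" using assms by (intro mult_mono) auto
  have t2: "t\<^sup>2 \<le> 1/4" using assms power_mono[of t "1/2" 2] by (simp add: power2_eq_square)
  define Q where "Q = (1 - t) * (1 - (z - 1) * t)"
  have "(z - 1) * t \<le> 1/2 * (1/2)" using assms by (intro mult_mono) auto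
  then have Q: "Q \<ge> 1/2 * (3/4)" unfolding Q_def using assms by (intro mult_mono) auto
  have Q_eq: "Q = 1 - z * t + (z - 1) * t\<^sup>2" by (simp add: Q_def algebra_simps power2_eq_square)
  have pos: "(1 - t) powr (z - 1) > 0" using assms by simp
  have "(1 - t) * (1 - t) powr (z - 1) * (1 - t\<^sup>2)\<^sup>2 \<le> Q * (1 - t\<^sup>2)\<^sup>2"
    unfolding Q_def using assms by (intro mult_right_mono mult_left_mono Bernoulli_powr) auto
  also have "\<dots> = 1 - z * t + t\<^sup>2 * ((z - 1) - Q * (2 - t\<^sup>2))"
    by (simp add: Q_eq algebra_simps power2_eq_square)
  also have "\<dots> \<le> 1 - z * t"
  proof -
    \<comment> \<open>The product 21/32 exceeds 1/2, the largest value of z - 1.\<close>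
    have "3/8 * (7/4) \<le> Q * (2 - t\<^sup>2)" using Q t2 by (intro mult_mono) auto
    then have "t\<^sup>2 * ((z - 1) - Q * (2 - t\<^sup>2)) \<le> 0" using assms by (intro mult_nonneg_nonpos) auto
    then show ?thesis by simp
  qed
  finally have "(1 - t) * ((1 - t) powr (z - 1) * (1 - t\<^sup>2)\<^sup>2) \<le> 1 - z * t" by (simp add: mult.assoc)
  moreover have "(1 - t) powr (z - 1) * (1 - t\<^sup>2)\<^sup>2 > 0" using pos t2 by simp
  moreover have "(1 / (1 - t)) powr (z - 1) * (1 / (1 - t\<^sup>2))\<^sup>2 = 1 / ((1 - t) powr (z - 1) * (1 - t\<^sup>2)\<^sup>2)"
    using assms by (simp add: powr_divide power_divide)
  ultimately show ?thesis using zt by (simp add: field_simps)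
qed

text \<open>The choice s = 1 + 1 / ln x turns x powr s into e * x and the bound for zeta(s) into 1 +
  ln x. The product for zeta(2 s) contributes at most 2^2, and 12 bounds 4 * e.\<close>

lemma sum_power_bigomega_le:
  fixes z :: real
  assumes "1 \<le> z" "z \<le> 3/2" "x \<ge> 2"
  shows "(\<Sum>n=1..x. z ^ bigomega n) \<le> 12 * real x * (1 + ln (real x)) powr (z - 1)"
proof -
  define s where "s = 1 + 1 / ln (real x)"
  have lnx: "ln (real x) > 0" using assms by simp
  then have s: "s > 1" by (simp add: s_def)
  have s': "s / (s - 1) = 1 + ln (real x)" using lnx by (simp add: s_def field_simps)
  have xs: "real x powr s = real x * exp 1"
    using assms lnx by (simp add: s_def powr_add) (simp add: powr_def)
  let ?P = "{p. prime p \<and> p \<le> x}"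
  let ?t = "\<lambda>p::nat. real p powr (-s)"
  have t: "0 < ?t p" "?t p \<le> 1/2" if "p \<in> ?P" for p
    using that s prime_powr_neg_bounds[of p s] by auto
  have t1: "1 / (1 - ?t p) \<ge> 0" if "p \<in> ?P" for p using t[OF that] by simp
  have t3: "1 / (1 - real p powr (-(2 * s))) \<ge> 0" if "p \<in> ?P" for p
    using that s prime_powr_neg_bounds[of p "2 * s"] by simp
  have t2: "(?t p)\<^sup>2 = real p powr (-(2 * s))" for p
    by (simp add: power2_eq_square powr_add[symmetric])
  have "(\<Sum>n=1..x. z ^ bigomega n) = (\<Sum>n=1..x. \<Prod>p\<in>?P. z ^ multiplicity p n)"
    by (intro sum.cong power_bigomega_eq_prod) auto
  also have "\<dots> \<le> real x powr s * (\<Prod>p\<in>?P. (1 - ?t p) / (1 - z * ?t p))"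
    using assms s by (intro sum_prime_weights_le) auto
  also have "(\<Prod>p\<in>?P. (1 - ?t p) / (1 - z * ?t p)) \<le>
      (\<Prod>p\<in>?P. (1 / (1 - ?t p)) powr (z - 1) * (1 / (1 - (?t p)\<^sup>2))\<^sup>2)"
  proof (intro prod_mono conjI)
    fix p assume p: "p \<in> ?P"
    have "z * ?t p \<le> 3/2 * (1/2)" using t[OF p] assms by (intro mult_mono) auto
    then show "0 \<le> (1 - ?t p) / (1 - z * ?t p)" using t[OF p] by simp
    show "(1 - ?t p) / (1 - z * ?t p) \<le> (1 / (1 - ?t p)) powr (z - 1) * (1 / (1 - (?t p)\<^sup>2))\<^sup>2"
      using t[OF p] assms by (intro euler_factor_le) auto
  qed
  also have "\<dots> = (\<Prod>p\<in>?P. 1 / (1 - ?t p)) powr (z - 1) * (\<Prod>p\<in>?P. 1 / (1 - real p powr (-(2 * s))))\<^sup>2"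
    by (simp only: prod_powr_distrib prod.distrib prod_power_distrib t2)
  also have "\<dots> \<le> (1 + ln (real x)) powr (z - 1) * 2\<^sup>2"
  proof (intro mult_mono powr_mono2 power_mono)
    show "(\<Prod>p\<in>?P. 1 / (1 - ?t p)) \<le> 1 + ln (real x)"
      unfolding s'[symmetric] using s by (intro zeta_euler_product_le) auto
    show "0 \<le> (\<Prod>p\<in>?P. 1 / (1 - ?t p))" using t1 by (intro prod_nonneg) auto
    have "(\<Prod>p\<in>?P. 1 / (1 - real p powr (-(2 * s)))) \<le> 2 * s / (2 * s - 1)"
      using s by (intro zeta_euler_product_le) auto
    also have "\<dots> \<le> 2" using s by (simp add: field_simps)
    finally show "(\<Prod>p\<in>?P. 1 / (1 - real p powr (-(2 * s)))) \<le> 2" .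
    show "0 \<le> (\<Prod>p\<in>?P. 1 / (1 - real p powr (-(2 * s))))"
      using t3 by (intro prod_nonneg) auto
  qed (use assms in auto)
  finally have "(\<Sum>n=1..x. z ^ bigomega n) \<le> real x powr s * ((1 + ln (real x)) powr (z - 1) * 2\<^sup>2)"
    by (simp add: mult_left_mono)
  also have "\<dots> = 4 * exp 1 * (real x * (1 + ln (real x)) powr (z - 1))" by (simp add: xs)
  also have "\<dots> \<le> 12 * (real x * (1 + ln (real x)) powr (z - 1))"
    using exp_le by (intro mult_right_mono) auto
  finally show ?thesis by simp
qed

text \<open>For w \<le> 1 the weight cannot increase under multiplication, so
  \<open>ln_times_sum_le_log_mean\<close> applies and supplies the division by ln x; an Euler
  product bounds the logarithmic mean. The constant is 5 * 3 with e \<le> 3.\<close>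

lemma sum_power_bigomega_le_small:
  fixes w :: real
  assumes "0 \<le> w" "w \<le> 1" "x \<ge> 2"
  shows "(\<Sum>n=1..x. w ^ bigomega n) \<le> 15 * real x * (1 + ln (real x)) powr w / ln (real x)"
proof -
  define s where "s = 1 + 1 / ln (real x)"
  have lnx: "ln (real x) > 0" using assms by simp
  then have s: "s > 1" by (simp add: s_def)
  have s': "s / (s - 1) = 1 + ln (real x)" using lnx by (simp add: s_def field_simps)
  let ?P = "{p. prime p \<and> p \<le> x}"
  let ?t = "\<lambda>p::nat. real p powr (-s)"
  have t: "0 < ?t p" "?t p \<le> 1/2" if "prime p" for p
    using that s prime_powr_neg_bounds[of p s] by auto
  have t1: "1 / (1 - ?t p) \<ge> 0" if "p \<in> ?P" for p using t[of p] that by simp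
  \<comment> \<open>Replacing 1 / n by n powr (-s) costs only a factor e, since n powr (1 / ln x)
    \<le> e for n \<le> x.\<close>
  have "(\<Sum>n=1..x. w ^ bigomega n / real n) \<le> (\<Sum>n=1..x. exp 1 * (w ^ bigomega n * ?t n))"
  proof (rule sum_mono)
    fix n assume n: "n \<in> {1..x}"
    have "real n powr (1 / ln (real x)) \<le> real x powr (1 / ln (real x))"
      using n lnx by (intro powr_mono2) auto
    also have "\<dots> = exp 1" using lnx assms by (simp add: powr_def)
    finally have "1 \<le> exp 1 * real n powr (- (1 / ln (real x)))"
      using n by (simp add: powr_minus field_simps)
    then have "1 / real n \<le> exp 1 * real n powr (- (1 / ln (real x))) / real n"
      by (intro divide_right_mono) auto
    also have "\<dots> = exp 1 * ?t n" using n by (simp add: s_def powr_diff powr_minus_divide)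
    finally have "w ^ bigomega n * (1 / real n) \<le> w ^ bigomega n * (exp 1 * ?t n)"
      using assms by (intro mult_left_mono) auto
    then show "w ^ bigomega n / real n \<le> exp 1 * (w ^ bigomega n * ?t n)" by (simp add: algebra_simps)
  qed
  also have "\<dots> = exp 1 * (\<Sum>n=1..x. w ^ bigomega n * ?t n)" by (simp add: sum_distrib_left)
  also have "(\<Sum>n=1..x. w ^ bigomega n * ?t n) \<le> (\<Prod>p\<in>?P. 1 / (1 - w ^ bigomega p * ?t p))"
  proof (rule sum_le_euler_product)
    show "w ^ bigomega p * ?t p < 1" if "prime p" for p
      using t[OF that] mult_mono[of w 1 "?t p" "1/2"] assms that by (simp add: bigomega_prime)
  qed (use assms in \<open>auto simp: bigomega_mult power_add powr_mult\<close>)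
  also have "\<dots> \<le> (\<Prod>p\<in>?P. (1 / (1 - ?t p)) powr w)"
  proof (intro prod_mono conjI)
    fix p assume p: "p \<in> ?P"
    have le: "(1 - ?t p) powr w \<le> 1 - w * ?t p"
      using t[of p] p assms by (intro Bernoulli_powr) auto
    moreover have "(1 - ?t p) powr w > 0" using t[of p] p by simp
    ultimately show "1 / (1 - w ^ bigomega p * ?t p) \<le> (1 / (1 - ?t p)) powr w"
      using p t[of p] by (simp add: bigomega_prime powr_divide frac_le)
    show "0 \<le> 1 / (1 - w ^ bigomega p * ?t p)"
      using less_le_trans[OF \<open>(1 - ?t p) powr w > 0\<close> le] p by (simp add: bigomega_prime)
  qed
  also have "\<dots> = (\<Prod>p\<in>?P. 1 / (1 - ?t p)) powr w"
    by (rule prod_powr_distrib[symmetric])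
  also have "\<dots> \<le> (1 + ln (real x)) powr w"
  proof (rule powr_mono2)
    show "(\<Prod>p\<in>?P. 1 / (1 - ?t p)) \<le> 1 + ln (real x)"
      unfolding s'[symmetric] using s by (intro zeta_euler_product_le) auto
    show "0 \<le> (\<Prod>p\<in>?P. 1 / (1 - ?t p))" using t1 by (intro prod_nonneg) auto
  qed (use assms in auto)
  finally have *: "(\<Sum>n=1..x. w ^ bigomega n / real n) \<le> exp 1 * (1 + ln (real x)) powr w"
    by simp
  have "ln (real x) * (\<Sum>n=1..x. w ^ bigomega n) \<le> 5 * real x * (\<Sum>n=1..x. w ^ bigomega n / real n)"
    using assms by (intro ln_times_sum_le_log_mean)
      (auto simp: bigomega_mult power_add mult_left_le power_le_one)
  also have "\<dots> \<le> 5 * real x * (3 * (1 + ln (real x)) powr w)"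
  proof (rule mult_left_mono)
    have "exp 1 * (1 + ln (real x)) powr w \<le> 3 * (1 + ln (real x)) powr w"
      using exp_le by (intro mult_right_mono) auto
    with * show "(\<Sum>n=1..x. w ^ bigomega n / real n) \<le> 3 * (1 + ln (real x)) powr w" by linarith
  qed auto
  finally show ?thesis using lnx by (simp add: pos_le_divide_eq mult_ac)
qed

text \<open>The exponent ln z / ln 2 is the one that converts Rankin weights in 2 ^
  \<open>bigomega\<close> into z ^ \<open>bigomega\<close>, and one less than it yields the weights
  (z / 2) ^ \<open>bigomega\<close>.\<close>

lemma two_power_powr:
  fixes z :: real
  assumes "z > 0"
  shows "(2 ^ k) powr (ln z / ln 2) = z ^ k" and "(2 ^ k) powr (ln z / ln 2 - 1) = (z / 2) ^ k"
proof -
  have "(2 ^ k) powr (ln z / ln 2) = (2 powr (ln z / ln 2)) ^ k"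
    by (simp add: powr_realpow[symmetric] powr_powr mult.commute)
  also have "2 powr (ln z / ln 2) = z" using assms by (simp add: powr_def)
  finally show *: "(2 ^ k) powr (ln z / ln 2) = z ^ k" .
  show "(2 ^ k) powr (ln z / ln 2 - 1) = (z / 2) ^ k"
    by (simp add: powr_diff * power_divide)
qed

section \<open>The multiplication table\<close>

definition mult_table :: "nat \<Rightarrow> nat set" where
  "mult_table M = (\<lambda>(u, v). u * v) ` ({1..M} \<times> {1..M})"

lemma finite_mult_table [simp]: "finite (mult_table M)"
  by (simp add: mult_table_def)

lemma mult_table_pos: "a \<in> mult_table M \<Longrightarrow> a > 0"
  by (auto simp: mult_table_def)

text \<open>Erdos' argument: a product \<open>u v\<close> of the table with \<open>2 ^ bigomega (u v) \<ge> ln M\<close> is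
  counted as an integer up to \<open>M\<^sup>2\<close>, the other products through the pair \<open>(u, v)\<close>, and both counts
  are estimated by Rankin's trick. Up to constants the two bounds coincide for every \<open>z\<close>.\<close>
lemma card_mult_table_le:
  fixes z :: real
  assumes z: "1 \<le> z" "z \<le> 3/2" and M: "M \<ge> 3"
  shows "real (card (mult_table M)) \<le> 936 * (real M)\<^sup>2 * ln (real M) powr (z - 1 - ln z / ln 2)"
proof -
  define \<theta> where "\<theta> = ln z / ln 2"
  define L where "L = ln (real M)"
  have "z \<le> 2" using z by simp
  then have th: "0 \<le> \<theta>" "\<theta> \<le> 1" using z by (auto simp: \<theta>_def)
  have "exp 1 \<le> real M" using exp_le M by linarith
  then have L: "L \<ge> 1" using M by (simp add: L_def ln_ge_iff)
  define X where "X n = 2 ^ bigomega n / L" for n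
  have X: "X n > 0" for n using L by (simp add: X_def)
  let ?T = "mult_table M"
  define G where "G = {n \<in> ?T. X n \<ge> 1}"
  define H where "H = {(u, v). u \<in> {1..M} \<and> v \<in> {1..M} \<and> X (u * v) < 1}"
  have fin: "finite G" "finite H"
    by (auto simp: G_def H_def intro: finite_subset[of _ "{1..M} \<times> {1..M}"])
  have "?T \<subseteq> G \<union> (\<lambda>(u, v). u * v) ` H"
    by (force simp: G_def H_def mult_table_def)
  then have "card ?T \<le> card (G \<union> (\<lambda>(u, v). u * v) ` H)"
    using fin by (intro card_mono) auto
  also have "\<dots> \<le> card G + card ((\<lambda>(u, v). u * v) ` H)" by (rule card_Un_le)
  also have "\<dots> \<le> card G + card H" using fin by (intro add_left_mono card_image_le)
  finally have card: "real (card ?T) \<le> real (card G) + real (card H)" by linarith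
  have "real (card G) = (\<Sum>n\<in>G. 1)" by simp
  \<comment> \<open>On \<open>G\<close> the base is at least 1 and \<theta> \<ge> 0, so every term
    is at least 1. Extended to all n up to M^2, the sum is a mean value of z ^
    \<open>bigomega n\<close>.\<close>
  also have "\<dots> \<le> (\<Sum>n\<in>G. X n powr \<theta>)"
    using th by (intro sum_mono) (auto simp: G_def ge_one_powr_ge_zero)
  also have "\<dots> \<le> (\<Sum>n=1..M\<^sup>2. X n powr \<theta>)"
    by (intro sum_mono2) (auto simp: G_def mult_table_def power2_eq_square Suc_le_eq intro: mult_le_mono)
  also have "\<dots> = L powr (-\<theta>) * (\<Sum>n=1..M\<^sup>2. z ^ bigomega n)"
    using L z by (simp add: X_def powr_divide \<theta>_def two_power_powr sum_distrib_left powr_minus_divide)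
  also have "\<dots> \<le> L powr (-\<theta>) * (36 * (real M)\<^sup>2 * L powr (z - 1))"
  proof (intro mult_left_mono)
    have "3 \<le> M\<^sup>2" using M power_increasing[of 1 2 M] by simp
    then have "(\<Sum>n=1..M\<^sup>2. z ^ bigomega n) \<le> 12 * real (M\<^sup>2) * (1 + ln (real (M\<^sup>2))) powr (z - 1)"
      using z by (intro sum_power_bigomega_le) auto
    also have "1 + ln (real (M\<^sup>2)) = 1 + 2 * L" using M by (simp add: L_def ln_realpow)
    also have "(1 + 2 * L) powr (z - 1) \<le> (3 * L) powr (z - 1)"
      using L z by (intro powr_mono2) auto
    also have "\<dots> = 3 powr (z - 1) * L powr (z - 1)" using L by (simp add: powr_mult)
    also have "\<dots> \<le> 3 * L powr (z - 1)"
      using powr_mono[of "z - 1" 1 3] z by (intro mult_right_mono) auto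
    finally show "(\<Sum>n=1..M\<^sup>2. z ^ bigomega n) \<le> 36 * (real M)\<^sup>2 * L powr (z - 1)"
      by (simp add: mult_left_mono)
  qed auto
  also have "\<dots> = 36 * (real M)\<^sup>2 * L powr (z - 1 - \<theta>)"
    using powr_add[of L "-\<theta>" "z - 1"] by (simp add: mult_ac)
  finally have G: "real (card G) \<le> 36 * (real M)\<^sup>2 * L powr (z - 1 - \<theta>)" .
  have X': "X (u * v) powr (\<theta> - 1) = L powr (1 - \<theta>) * ((z / 2) ^ bigomega u * (z / 2) ^ bigomega v)"
    if "u > 0" "v > 0" for u v
    using L z that two_power_powr(2)[of z "bigomega (u * v)"] powr_minus_divide[of L "\<theta> - 1"]
    by (simp add: X_def powr_divide \<theta>_def bigomega_mult power_add[symmetric])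
  have S: "(\<Sum>u=1..M. (z / 2) ^ bigomega u) \<le> 30 * real M * L powr (z / 2 - 1)"
  proof -
    have "(\<Sum>u=1..M. (z / 2) ^ bigomega u) \<le> 15 * real M * (1 + L) powr (z / 2) / L"
      unfolding L_def using z M by (intro sum_power_bigomega_le_small) auto
    also have "\<dots> \<le> 15 * real M * (2 * L powr (z / 2)) / L"
    proof (intro divide_right_mono mult_left_mono)
      have "(1 + L) powr (z / 2) \<le> (2 * L) powr (z / 2)"
        using L z by (intro powr_mono2) auto
      also have "\<dots> = 2 powr (z / 2) * L powr (z / 2)" using L by (simp add: powr_mult)
      also have "\<dots> \<le> 2 * L powr (z / 2)"
        using powr_mono[of "z / 2" 1 2] z by (intro mult_right_mono) auto
      finally show "(1 + L) powr (z / 2) \<le> 2 * L powr (z / 2)" .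
    qed (use L in auto)
    also have "\<dots> = 30 * real M * L powr (z / 2 - 1)" using L by (simp add: powr_diff)
    finally show ?thesis .
  qed
  have "real (card H) = (\<Sum>(u, v)\<in>H. 1)" by (simp add: case_prod_unfold)
  \<comment> \<open>On \<open>H\<close> the base is below 1 and the exponent \<theta> - 1 is
    nonpositive. Since \<open>bigomega\<close> is additive, the sum over all pairs becomes the
    square of a mean value with z / 2.\<close>
  also have "\<dots> \<le> (\<Sum>(u, v)\<in>H. X (u * v) powr (\<theta> - 1))"
  proof (intro sum_mono, clarify)
    fix u v assume "(u, v) \<in> H"
    then have "X (u * v) powr 0 \<le> X (u * v) powr (\<theta> - 1)"
      using X[of "u * v"] th by (intro powr_mono') (auto simp: H_def)
    then show "1 \<le> X (u * v) powr (\<theta> - 1)" using X[of "u * v"] by simp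
  qed
  also have "\<dots> \<le> (\<Sum>(u, v)\<in>{1..M} \<times> {1..M}. X (u * v) powr (\<theta> - 1))"
    by (intro sum_mono2) (auto simp: H_def)
  also have "\<dots> = (\<Sum>u=1..M. \<Sum>v=1..M. X (u * v) powr (\<theta> - 1))"
    by (rule sum.cartesian_product[symmetric])
  also have "\<dots> = (\<Sum>u=1..M. \<Sum>v=1..M. L powr (1 - \<theta>) * ((z / 2) ^ bigomega u * (z / 2) ^ bigomega v))"
    by (intro sum.cong X') auto
  also have "\<dots> = L powr (1 - \<theta>) * (\<Sum>u=1..M. (z / 2) ^ bigomega u)\<^sup>2"
    unfolding power2_eq_square sum_product by (simp only: sum_distrib_left)
  also have "\<dots> \<le> L powr (1 - \<theta>) * (30 * real M * L powr (z / 2 - 1))\<^sup>2"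
    using S z by (intro mult_left_mono power_mono sum_nonneg) auto
  \<comment> \<open>The exponents add up to (1 - \<theta>) + 2 (z / 2 - 1) = z - 1 - \<theta>, the
    same as for \<open>G\<close>; the constants 36 and 900 give 936.\<close>
  also have "\<dots> = 900 * (real M)\<^sup>2 * L powr (z - 1 - \<theta>)"
  proof -
    have "(L powr (z / 2 - 1))\<^sup>2 = L powr (z - 2)"
      by (simp add: power2_eq_square powr_add[symmetric])
    then have "L powr (1 - \<theta>) * (L powr (z / 2 - 1))\<^sup>2 = L powr (z - 1 - \<theta>)"
      by (simp add: powr_add[symmetric] algebra_simps)
    then show ?thesis by (simp add: power_mult_distrib)
  qed
  finally have "real (card H) \<le> 900 * (real M)\<^sup>2 * L powr (z - 1 - \<theta>)" .
  with card G show ?thesis unfolding \<theta>_def L_def by linarith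
qed

section \<open>The spectrum\<close>

text \<open>This makes the definite description in \<open>lam\<close> meaningful. The element of the
  next rank is the least one above the current element; uniqueness holds because the rank increases
  strictly along S.\<close>

lemma ex1_rank:
  fixes S :: "real set"
  assumes inf: "infinite S" and fin: "\<And>x. finite {y \<in> S. y \<le> x}"
  shows "\<exists>!x. x \<in> S \<and> card {y \<in> S. y < x} = n"
proof -
  have fin': "finite {y \<in> S. y < x}" for x
    by (rule finite_subset[OF _ fin[of x]]) auto
  have strict: "card {y \<in> S. y < x} < card {y \<in> S. y < x'}" if "x \<in> S" "x < x'" for x x'
    using that fin' by (intro psubset_card_mono) auto
  \<comment> \<open>Only finitely many elements lie below a given witness, so a minimum can be taken
    among them.\<close>
  have least: "\<exists>x\<in>S. P x \<and> (\<forall>y\<in>S. P y \<longrightarrow> x \<le> y)" if "x\<^sub>0 \<in> S" "P x\<^sub>0" for P x\<^sub>0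
  proof -
    define F where "F = {y \<in> S. y \<le> x\<^sub>0 \<and> P y}"
    have F: "finite F" "F \<noteq> {}"
      using that by (auto simp: F_def intro: finite_subset[OF _ fin[of x\<^sub>0]])
    have "Min F \<in> F" using F by (rule Min_in)
    moreover have "Min F \<le> y" if "y \<in> S" "P y" for y
    proof (cases "y \<le> x\<^sub>0")
      case True
      then show ?thesis using F that by (intro Min_le) (auto simp: F_def)
    next
      case False
      then show ?thesis using \<open>Min F \<in> F\<close> by (auto simp: F_def)
    qed
    ultimately show ?thesis by (auto simp: F_def)
  qed
  have "\<exists>x\<in>S. card {y \<in> S. y < x} = n"
  proof (induction n)
    case 0
    obtain x\<^sub>0 where "x\<^sub>0 \<in> S" using inf by (metis ex_in_conv finite.emptyI)
    from least[of x\<^sub>0 "\<lambda>_. True", OF this] obtain x where x: "x \<in> S" "\<forall>y\<in>S. x \<le> y" by auto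
    then have "{y \<in> S. y < x} = {}" by force
    then have "card {y \<in> S. y < x} = 0" by (simp only: card.empty)
    then show ?case using x by blast
  next
    case (Suc n)
    then obtain x where x: "x \<in> S" "card {y \<in> S. y < x} = n" by auto
    have "\<not> S \<subseteq> {y \<in> S. y \<le> x}" using fin[of x] inf finite_subset by blast
    then obtain x\<^sub>0 where "x\<^sub>0 \<in> S" "x < x\<^sub>0" by force
    from least[of x\<^sub>0 "\<lambda>y. x < y", OF this] obtain x' where
      x': "x' \<in> S" "x < x'" "\<forall>y\<in>S. x < y \<longrightarrow> x' \<le> y" by auto
    then have "{y \<in> S. y < x'} = insert x {y \<in> S. y < x}" using x by force
    then have "card {y \<in> S. y < x'} = Suc n" using x fin' by simp
    then show ?case using x' by auto
  qed
  moreover have "x = x'" if "x \<in> S" "x' \<in> S" "card {y \<in> S. y < x} = card {y \<in> S. y < x'}" for x x'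
    using strict[of x x'] strict[of x' x] that by (metis less_irrefl linorder_neqE)
  ultimately show ?thesis by metis
qed

context
  fixes \<alpha> :: real
  assumes pos: "\<alpha> > 0" and irrational: "\<alpha> \<notin> \<rat>"
begin

text \<open>If m and m' differed, \<alpha> would be a quotient of two integers; positivity then
  fixes the signs of the square roots.\<close>

lemma spec_set_inj:
  fixes m n m' n' :: int
  assumes "\<alpha> * (of_int m)\<^sup>2 + (of_int n)\<^sup>2 = \<alpha> * (of_int m')\<^sup>2 + (of_int n')\<^sup>2"
    and "m \<ge> 1" "n \<ge> 1" "m' \<ge> 1" "n' \<ge> 1"
  shows "m = m' \<and> n = n'"
proof -
  have "\<alpha> * of_int (m\<^sup>2 - m'\<^sup>2) = of_int (n'\<^sup>2 - n\<^sup>2)"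
    using assms(1) by (simp add: algebra_simps)
  moreover have "\<alpha> \<noteq> of_int (n'\<^sup>2 - n\<^sup>2) / of_int (m\<^sup>2 - m'\<^sup>2)"
    using irrational by (metis Rats_divide Rats_of_int)
  ultimately have "m\<^sup>2 - m'\<^sup>2 = 0"
    by (metis nonzero_eq_divide_eq of_int_eq_0_iff)
  then have "m = m'" using assms by (simp add: power2_eq_iff)
  then have "(of_int n :: real)\<^sup>2 = (of_int n')\<^sup>2" using assms(1) by simp
  then have "n = n'" using assms by (simp add: power2_eq_iff)
  then show ?thesis using \<open>m = m'\<close> by simp
qed

lemma finite_spec_set_le: "finite {y \<in> spec_set \<alpha>. y \<le> x}"
proof -
  have "{y \<in> spec_set \<alpha>. y \<le> x} \<subseteq>
      (\<lambda>(m, n). \<alpha> * (of_int m)\<^sup>2 + (of_int n)\<^sup>2) ` ({1..\<lfloor>x / \<alpha>\<rfloor>} \<times> {1..\<lfloor>x\<rfloor>})"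
  proof
    fix y assume "y \<in> {y \<in> spec_set \<alpha>. y \<le> x}"
    then obtain m n :: int where y: "y = \<alpha> * (of_int m)\<^sup>2 + (of_int n)\<^sup>2" "m \<ge> 1" "n \<ge> 1" "y \<le> x"
      by (auto simp: spec_set_def)
    have sq: "(of_int j :: real) \<le> (of_int j)\<^sup>2" if "j \<ge> 1" for j :: int
      using that by (simp add: power2_eq_square mult_le_cancel_left1)
    have "\<alpha> * of_int m \<le> \<alpha> * (of_int m)\<^sup>2" using pos sq y by (intro mult_left_mono) auto
    moreover have "0 \<le> \<alpha> * (of_int m)\<^sup>2" using pos by simp
    ultimately have "of_int n \<le> x" "\<alpha> * of_int m \<le> x" using y sq[of n] by (smt (verit) zero_le_power2)+
    then have "n \<le> \<lfloor>x\<rfloor>" "m \<le> \<lfloor>x / \<alpha>\<rfloor>" using pos by (auto simp: le_floor_iff field_simps)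
    then show "y \<in> (\<lambda>(m, n). \<alpha> * (of_int m)\<^sup>2 + (of_int n)\<^sup>2) ` ({1..\<lfloor>x / \<alpha>\<rfloor>} \<times> {1..\<lfloor>x\<rfloor>})"
      using y by auto
  qed
  then show ?thesis by (rule finite_subset) auto
qed

text \<open>This crude count takes the place of a lattice point asymptotic in locating the first k^2
  values of the spectrum.\<close>

lemma card_spec_set_box:
  fixes k :: nat
  defines "A \<equiv> (\<lambda>(m::int, n::int). \<alpha> * (of_int m)\<^sup>2 + (of_int n)\<^sup>2) ` ({1..int k} \<times> {1..int k})"
  shows "card A = k\<^sup>2" "A \<subseteq> {y \<in> spec_set \<alpha>. y \<le> (\<alpha> + 1) * (real k)\<^sup>2}"
proof -
  have "inj_on (\<lambda>(m::int, n::int). \<alpha> * (of_int m)\<^sup>2 + (of_int n)\<^sup>2) ({1..int k} \<times> {1..int k})"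
    by (auto simp: inj_on_def dest!: spec_set_inj)
  then show "card A = k\<^sup>2"
    by (simp add: A_def card_image card_cartesian_product power2_eq_square)
  show "A \<subseteq> {y \<in> spec_set \<alpha>. y \<le> (\<alpha> + 1) * (real k)\<^sup>2}"
  proof
    fix y assume "y \<in> A"
    then obtain m n :: int where y: "y = \<alpha> * (of_int m)\<^sup>2 + (of_int n)\<^sup>2"
      "1 \<le> m" "m \<le> int k" "1 \<le> n" "n \<le> int k" by (auto simp: A_def)
    then have "(of_int m)\<^sup>2 \<le> (real k)\<^sup>2" "(of_int n)\<^sup>2 \<le> (real k)\<^sup>2" by (auto intro!: power_mono)
    then have "y \<le> \<alpha> * (real k)\<^sup>2 + (real k)\<^sup>2"
      unfolding y(1) using pos by (intro add_mono mult_left_mono) auto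
    then show "y \<in> {y \<in> spec_set \<alpha>. y \<le> (\<alpha> + 1) * (real k)\<^sup>2}"
      using y by (auto simp: spec_set_def algebra_simps)
  qed
qed

lemma infinite_spec_set: "infinite (spec_set \<alpha>)"
proof
  assume fin: "finite (spec_set \<alpha>)"
  have "k\<^sup>2 \<le> card (spec_set \<alpha>)" for k
    unfolding card_spec_set_box(1)[of k, symmetric]
    by (rule card_mono[OF fin order_trans[OF card_spec_set_box(2)]]) auto
  from this[of "Suc (card (spec_set \<alpha>))"] show False by (simp add: power2_eq_square)
qed

lemma lam_rank:
  "lam \<alpha> i \<in> spec_set \<alpha>" "card {y \<in> spec_set \<alpha>. y < lam \<alpha> i} = i - 1"
  using theI'[OF ex1_rank[OF infinite_spec_set finite_spec_set_le]] unfolding lam_def by auto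

lemma lam_less:
  assumes "1 \<le> i" "i < j"
  shows "lam \<alpha> i < lam \<alpha> j"
proof (rule ccontr)
  assume "\<not> lam \<alpha> i < lam \<alpha> j"
  then have "card {y \<in> spec_set \<alpha>. y < lam \<alpha> j} \<le> card {y \<in> spec_set \<alpha>. y < lam \<alpha> i}"
    by (intro card_mono finite_subset[OF _ finite_spec_set_le[of "lam \<alpha> i"]]) auto
  then show False using assms by (simp add: lam_rank)
qed

text \<open>A larger value would have all k^2 values of the box below it, but its rank allows only i
  - 1.\<close>

lemma lam_square_le:
  assumes "1 \<le> i" "i \<le> k\<^sup>2"
  shows "lam \<alpha> i \<le> (\<alpha> + 1) * (real k)\<^sup>2"
proof (rule ccontr)
  assume less: "\<not> lam \<alpha> i \<le> (\<alpha> + 1) * (real k)\<^sup>2"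
  let ?A = "(\<lambda>(m::int, n::int). \<alpha> * (of_int m)\<^sup>2 + (of_int n)\<^sup>2) ` ({1..int k} \<times> {1..int k})"
  have "card ?A \<le> card {y \<in> spec_set \<alpha>. y < lam \<alpha> i}"
  proof (rule card_mono[OF _ order_trans[OF card_spec_set_box(2)]])
    show "finite {y \<in> spec_set \<alpha>. y < lam \<alpha> i}"
      by (rule finite_subset[OF _ finite_spec_set_le[of "lam \<alpha> i"]]) auto
  qed (use less in auto)
  then show False using assms card_spec_set_box(1)[of k] by (simp add: lam_rank)
qed

end

section \<open>Exceptional values of \<open>\<alpha>\<close>\<close>

lemma lam_gap_cases:
  assumes pos: "\<alpha> > 0" and irrational: "\<alpha> \<notin> \<rat>"
    and q: "q \<ge> 1" "1 / real q \<le> \<alpha>" and i: "1 \<le> i" "i < k\<^sup>2"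
  shows "lam \<alpha> (i + 1) - lam \<alpha> i \<ge> 1 \<or>
    (\<exists>a\<in>mult_table (4 * q * k). \<exists>b::int. lam \<alpha> (i + 1) - lam \<alpha> i = \<bar>\<alpha> * real a - of_int b\<bar>)"
proof -
  define gap where "gap = lam \<alpha> (i + 1) - lam \<alpha> i"
  have gap: "gap > 0" using lam_less[OF pos irrational, of i "i + 1"] i by (simp add: gap_def)
  have coord: "\<exists>m n::int. lam \<alpha> j = \<alpha> * (of_int m)\<^sup>2 + (of_int n)\<^sup>2 \<and> 1 \<le> m \<and> m \<le> int (2 * q * k)"
    if j: "1 \<le> j" "j \<le> k\<^sup>2" for j
  proof -
    obtain m n :: int where mn: "lam \<alpha> j = \<alpha> * (of_int m)\<^sup>2 + (of_int n)\<^sup>2" "1 \<le> m"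
      using lam_rank(1)[OF pos irrational, of j] by (auto simp: spec_set_def)
    have "\<alpha> * (of_int m)\<^sup>2 \<le> (\<alpha> + 1) * (real k)\<^sup>2"
      using lam_square_le[OF pos irrational j] mn zero_le_power2[of "of_int n :: real"] by linarith
    \<comment> \<open>From 1 \<le> \<alpha> * q follows \<alpha> + 1 \<le> \<alpha> * (1 + q) \<le>
      \<alpha> * (2 * q)^2. Hence m \<le> 2 * q * k, and m + m' stays within the side 4 * q * k of
      the table.\<close>
    also have "\<dots> \<le> \<alpha> * ((2 * real q)\<^sup>2 * (real k)\<^sup>2)"
    proof -
      have "1 \<le> \<alpha> * real q" using q by (simp add: field_simps)
      then have "\<alpha> + 1 \<le> \<alpha> * (1 + real q)" by (simp add: algebra_simps)
      also have "\<dots> \<le> \<alpha> * (2 * real q)\<^sup>2"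
      proof (intro mult_left_mono)
        have "real q \<le> (real q)\<^sup>2" using q by (simp add: power2_eq_square mult_le_cancel_left1)
        moreover have "1 \<le> real q" using q by simp
        ultimately have "1 + real q \<le> 4 * (real q)\<^sup>2" by linarith
        then show "1 + real q \<le> (2 * real q)\<^sup>2" by (simp add: power_mult_distrib)
      qed (use pos in auto)
      finally have "(\<alpha> + 1) * (real k)\<^sup>2 \<le> \<alpha> * (2 * real q)\<^sup>2 * (real k)\<^sup>2"
        by (rule mult_right_mono) auto
      then show ?thesis by (simp add: mult.assoc)
    qed
    finally have "(of_int m)\<^sup>2 \<le> (2 * real q * real k)\<^sup>2" using pos by (simp add: power_mult_distrib)
    then have "of_int m \<le> 2 * real q * real k" by (rule power2_le_imp_le) auto
    then have "of_int m \<le> (of_int (int (2 * q * k)) :: real)" by simp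
    then have "m \<le> int (2 * q * k)" by (simp only: of_int_le_iff)
    then show ?thesis using mn by blast
  qed
  obtain m n :: int where mn: "lam \<alpha> i = \<alpha> * (of_int m)\<^sup>2 + (of_int n)\<^sup>2" "1 \<le> m" "m \<le> int (2 * q * k)"
    using coord[of i] i by auto
  obtain m' n' :: int where mn': "lam \<alpha> (i + 1) = \<alpha> * (of_int m')\<^sup>2 + (of_int n')\<^sup>2"
      "1 \<le> m'" "m' \<le> int (2 * q * k)"
    using coord[of "i + 1"] i by auto
  show ?thesis
  proof (cases "m = m'")
    case True
    then have eq: "gap = of_int (n'\<^sup>2 - n\<^sup>2)" using mn mn' by (simp add: gap_def)
    with gap have "n'\<^sup>2 - n\<^sup>2 \<ge> 1" by (metis of_int_0_less_iff int_one_le_iff_zero_less)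
    then have "gap \<ge> 1" unfolding eq by (metis of_int_le_iff of_int_1)
    then show ?thesis by (simp add: gap_def)
  next
    case False
    define u where "u = nat \<bar>m' - m\<bar>"
    define v where "v = nat (m' + m)"
    have uv: "u \<in> {1..4 * q * k}" "v \<in> {1..4 * q * k}"
      using False mn mn' by (auto simp: u_def v_def nat_le_iff)
    then have T: "u * v \<in> mult_table (4 * q * k)" by (auto simp: mult_table_def)
    \<comment> \<open>The sign makes the difference of squares the product of the natural numbers
      \<open>u\<close> and \<open>v\<close>; it is passed on to the integer b, and the absolute
      value removes what is left of it.\<close>
    define \<sigma> where "\<sigma> = sgn (m' - m)"
    have sg: "\<sigma> = 1 \<or> \<sigma> = -1" using False by (auto simp: \<sigma>_def sgn_if)
    have "int (u * v) = \<sigma> * (m' - m) * (m' + m)"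
    proof -
      have "\<sigma> * (m' - m) = \<bar>m' - m\<bar>" by (simp add: \<sigma>_def abs_sgn mult.commute)
      moreover have "int u = \<bar>m' - m\<bar>" "int v = m' + m" using mn mn' by (simp_all add: u_def v_def)
      ultimately show ?thesis by (simp only: of_nat_mult)
    qed
    then have "real (u * v) = of_int (\<sigma> * (m' - m) * (m' + m))"
      by (metis of_int_of_nat_eq)
    then have a: "real (u * v) = of_int \<sigma> * ((of_int m')\<^sup>2 - (of_int m)\<^sup>2)"
      by (simp add: algebra_simps power2_eq_square)
    have "gap = \<alpha> * ((of_int m')\<^sup>2 - (of_int m)\<^sup>2) + ((of_int n')\<^sup>2 - (of_int n)\<^sup>2)"
      using mn mn' by (simp add: gap_def algebra_simps)
    also have "\<dots> = of_int \<sigma> * (\<alpha> * real (u * v) - of_int (\<sigma> * (n\<^sup>2 - n'\<^sup>2)))"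
      unfolding a using sg by (auto simp: algebra_simps)
    finally have "\<bar>gap\<bar> = \<bar>\<alpha> * real (u * v) - of_int (\<sigma> * (n\<^sup>2 - n'\<^sup>2))\<bar>"
      using sg by (auto simp: abs_mult)
    then have "gap = \<bar>\<alpha> * real (u * v) - of_int (\<sigma> * (n\<^sup>2 - n'\<^sup>2))\<bar>" using gap by simp
    then show ?thesis using T unfolding gap_def by blast
  qed
qed

text \<open>For 0 < \<alpha> \<le> q and \<delta> \<le> 1, an integer b at distance less than
  \<delta> from \<alpha> * a lies between 0 and q * a + 1, so finitely many intervals
  suffice.\<close>

definition near_rationals :: "nat \<Rightarrow> nat \<Rightarrow> real \<Rightarrow> real set" where
  "near_rationals q M \<delta> = (\<Union>a\<in>mult_table M. \<Union>b\<in>{0..q * a + 1}.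
     {(real b - \<delta>) / real a .. (real b + \<delta>) / real a})"

lemma near_rationals_borel [measurable]: "near_rationals q M \<delta> \<in> sets lborel"
  unfolding near_rationals_def by (intro sets.finite_UN) auto

text \<open>An entry a yields q * a + 2 intervals of length 2 * \<delta> / a, and (q * a + 2) / a
  \<le> q + 2. The bound is uniform in a, so only the number of distinct entries counts.\<close>

lemma emeasure_near_rationals_le:
  assumes "\<delta> \<ge> 0"
  shows "emeasure lborel (near_rationals q M \<delta>) \<le>
    ennreal (real (card (mult_table M)) * (2 * (real q + 2) * \<delta>))"
proof -
  have "emeasure lborel (near_rationals q M \<delta>) \<le> (\<Sum>a\<in>mult_table M.
      emeasure lborel (\<Union>b\<in>{0..q * a + 1}. {(real b - \<delta>) / real a .. (real b + \<delta>) / real a}))"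
    unfolding near_rationals_def by (intro emeasure_subadditive_finite) (auto intro!: sets.finite_UN)
  also have "\<dots> \<le> (\<Sum>a\<in>mult_table M. ennreal (2 * (real q + 2) * \<delta>))"
  proof (rule sum_mono)
    fix a assume "a \<in> mult_table M"
    then have a: "real a \<ge> 1" using mult_table_pos[of a M] by simp
    have "emeasure lborel (\<Union>b\<in>{0..q * a + 1}. {(real b - \<delta>) / real a .. (real b + \<delta>) / real a}) \<le>
        (\<Sum>b\<in>{0..q * a + 1}. emeasure lborel {(real b - \<delta>) / real a .. (real b + \<delta>) / real a})"
      by (intro emeasure_subadditive_finite) auto
    also have "\<dots> = (\<Sum>b\<in>{0..q * a + 1}. ennreal (2 * \<delta> / real a))"
      using assms by (intro sum.cong) (auto simp: divide_right_mono diff_divide_distrib[symmetric])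
    also have "\<dots> = ennreal (\<Sum>b\<in>{0..q * a + 1}. 2 * \<delta> / real a)"
      using assms by (intro sum_ennreal) auto
    also have "\<dots> \<le> ennreal (2 * (real q + 2) * \<delta>)"
    proof (rule ennreal_leI)
      have "real q * real a + 2 \<le> (real q + 2) * real a" using a by (simp add: algebra_simps)
      then have "(real q * real a + 2) / real a * (2 * \<delta>) \<le> (real q + 2) * (2 * \<delta>)"
        using a assms by (intro mult_right_mono) (auto simp: pos_divide_le_eq)
      then show "(\<Sum>b\<in>{0..q * a + 1}. 2 * \<delta> / real a) \<le> 2 * (real q + 2) * \<delta>"
        by (simp add: mult_ac add.commute)
    qed
    finally show "emeasure lborel (\<Union>b\<in>{0..q * a + 1}. {(real b - \<delta>) / real a .. (real b + \<delta>) / real a})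
      \<le> ennreal (2 * (real q + 2) * \<delta>)" .
  qed
  also have "\<dots> = ennreal (real (card (mult_table M)) * (2 * (real q + 2) * \<delta>))"
    using assms by (subst sum_ennreal) auto
  finally show ?thesis .
qed

lemma delta_min_ge:
  assumes pos: "\<alpha> > 0" and irrational: "\<alpha> \<notin> \<rat>"
    and q: "q \<ge> 1" "1 / real q \<le> \<alpha>" "\<alpha> \<le> real q" and k: "k \<ge> 2"
    and \<delta>: "0 \<le> \<delta>" "\<delta> \<le> 1" and notin: "\<alpha> \<notin> near_rationals q (4 * q * k) \<delta>"
  shows "delta_min \<alpha> (k\<^sup>2) \<ge> \<delta>"
proof -
  have "lam \<alpha> (i + 1) - lam \<alpha> i \<ge> \<delta>" if i: "1 \<le> i" "i < k\<^sup>2" for i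
  proof (rule ccontr)
    assume less: "\<not> lam \<alpha> (i + 1) - lam \<alpha> i \<ge> \<delta>"
    \<comment> \<open>As \<delta> \<le> 1, a gap below \<delta> rules out the first alternative of
      \<open>lam_gap_cases\<close>.\<close>
    then obtain a b where ab: "a \<in> mult_table (4 * q * k)" "\<bar>\<alpha> * real a - of_int b\<bar> < \<delta>"
      using lam_gap_cases[OF pos irrational q(1,2) i] \<delta> by (metis not_le order_trans)
    have a: "a > 0" using ab mult_table_pos by blast
    then have "\<alpha> * real a > 0" "\<alpha> * real a \<le> real q * real a"
      using pos q by auto
    then have "of_int b > (-1 :: real)" "of_int b < real q * real a + 1" using ab \<delta> by linarith+
    then have "b \<ge> 0" "of_int b < (of_int (int (q * a + 1)) :: real)" by auto
    then have b: "b \<ge> 0" "b \<le> int (q * a + 1)" by (simp_all only: of_int_less_iff)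
    then have "real (nat b) = of_int b" by simp
    then have "(real (nat b) - \<delta>) / real a \<le> \<alpha>" "\<alpha> \<le> (real (nat b) + \<delta>) / real a"
      using ab a by (auto simp: pos_divide_le_eq pos_le_divide_eq)
    moreover have "nat b \<in> {0..q * a + 1}" using b by (auto simp: nat_le_iff)
    ultimately have "\<alpha> \<in> near_rationals q (4 * q * k) \<delta>"
      using ab unfolding near_rationals_def by (intro UN_I[of a] UN_I[of "nat b"]) auto
    with notin show False by contradiction
  qed
  \<comment> \<open>\<open>Min\<close> is meaningful only on a nonempty finite set; k \<ge> 2 admits
    i = 1.\<close>
  moreover have "2 \<le> k\<^sup>2" using k power_increasing[of 1 2 k] by simp
  then have "{lam \<alpha> (i + 1) - lam \<alpha> i | i. 1 \<le> i \<and> i < k\<^sup>2} \<noteq> {}" by force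
  moreover have "finite {lam \<alpha> (i + 1) - lam \<alpha> i | i. 1 \<le> i \<and> i < k\<^sup>2}" by simp
  ultimately show ?thesis unfolding delta_min_def by (subst Min_ge_iff) auto
qed

text \<open>For fixed j, the points that lie in \<open>U j k\<close> for all large k form an
  increasing union over K of sets each contained in a single \<open>U j k\<close>, so their measure
  is at most D / (j + 1). A point violating the claim has this property for every j, and j may tend
  to infinity.\<close>

lemma AE_not_eventually_in:
  fixes U :: "nat \<Rightarrow> nat \<Rightarrow> 'a set"
  assumes [measurable]: "\<And>j k. U j k \<in> sets M"
    and le: "\<And>j k. k \<ge> k\<^sub>0 \<Longrightarrow> emeasure M (U j k) \<le> ennreal (D / real (Suc j))"
  shows "AE x in M. \<exists>j. \<exists>\<^sub>\<infinity>k. x \<notin> U j k"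
proof (rule AE_I')
  define L where "L j = (\<Union>K. \<Inter>k\<in>{K..}. U j k)" for j
  have meas: "L j \<in> sets M" for j unfolding L_def by measurable
  have L: "emeasure M (L j) \<le> ennreal (D / real (Suc j))" for j
  proof -
    have "emeasure M (L j) = (SUP K. emeasure M (\<Inter>k\<in>{K..}. U j k))"
      unfolding L_def by (intro SUP_emeasure_incseq[symmetric]) (auto simp: incseq_def)
    also have "\<dots> \<le> ennreal (D / real (Suc j))"
    proof (rule SUP_least)
      fix K
      have "emeasure M (\<Inter>k\<in>{K..}. U j k) \<le> emeasure M (U j (max K k\<^sub>0))"
        by (intro emeasure_mono) auto
      also have "\<dots> \<le> ennreal (D / real (Suc j))" by (rule le) auto
      finally show "emeasure M (\<Inter>k\<in>{K..}. U j k) \<le> ennreal (D / real (Suc j))" .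
    qed
    finally show ?thesis .
  qed
  have "(\<lambda>j. ennreal (D / real (Suc j))) \<longlonglongrightarrow> ennreal 0"
    using tendsto_mult[OF tendsto_const LIMSEQ_inverse_real_of_nat, of D]
    by (intro tendsto_ennrealI) (simp add: divide_inverse)
  moreover have "emeasure M (\<Inter>j. L j) \<le> ennreal (D / real (Suc j))" for j
    by (rule order_trans[OF emeasure_mono L[of j]]) (use meas in auto)
  ultimately have "emeasure M (\<Inter>j. L j) \<le> ennreal 0"
    by (intro LIMSEQ_le_const) auto
  then show "(\<Inter>j. L j) \<in> null_sets M" using meas by (auto simp: null_sets_def)
  show "{x \<in> space M. \<not> (\<exists>j. \<exists>\<^sub>\<infinity>k. x \<notin> U j k)} \<subseteq> (\<Inter>j. L j)"
  proof (intro subsetI INT_I)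
    fix x j assume "x \<in> {x \<in> space M. \<not> (\<exists>j. \<exists>\<^sub>\<infinity>k. x \<notin> U j k)}"
    then obtain K where "\<forall>k\<ge>K. x \<in> U j k" unfolding INFM_nat_le by blast
    then show "x \<in> L j" unfolding L_def by (intro UN_I[of K]) auto
  qed
qed

section \<open>The exponent \<open>c\<close> and the measure bound at the critical scale\<close>

lemma exponent_nonneg: "0 \<le> 1 - ln (exp 1 * ln 2) / ln (2::real)"
proof -
  have "ln (ln 2 :: real) \<le> ln 2 - 1" by (intro ln_le_minus_one) auto
  then show ?thesis by (simp add: ln_mult field_simps)
qed

lemma exponent_le_1: "1 - ln (exp 1 * ln 2) / ln (2::real) \<le> 1"
proof -
  have "2 * (2 / 3) \<le> exp 1 * ln (2::real)"
    using ln2_ge_two_thirds exp_ge_add_one_self[of 1] by (intro mult_mono) auto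
  then have "ln (exp 1 * ln (2::real)) \<ge> 0" by (intro ln_ge_zero) auto
  then show ?thesis by simp
qed

text \<open>The bound is uniform in k: the logarithmic saving of the multiplication table cancels
  the logarithm in \<delta>, and M^2 = 16 q^2 k^2 cancels its denominator. The constant is 936 * 16
  * 2 * 2.\<close>

lemma emeasure_near_rationals_log_le:
  fixes c :: real
  defines "c \<equiv> 1 - ln (exp 1 * ln 2) / ln 2"
  assumes q: "q \<ge> 1" and k: "k \<ge> 3" and C: "C \<ge> 0"
  shows "emeasure lborel (near_rationals q (4 * q * k) (C * ln (real (k\<^sup>2)) powr c / real (k\<^sup>2))) \<le>
    ennreal (59904 * (real q)\<^sup>2 * (real q + 2) * C)"
proof -
  define \<delta> where "\<delta> = C * ln (real (k\<^sup>2)) powr c / real (k\<^sup>2)"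
  have \<delta>: "\<delta> \<ge> 0" using C by (simp add: \<delta>_def)
  have ln2: "2 / 3 \<le> ln (2::real)" "ln (2::real) < 1" using ln2_ge_two_thirds ln_2_less_1 by auto
  have c: "0 \<le> c" "c \<le> 1" unfolding c_def by (rule exponent_nonneg, rule exponent_le_1)
  let ?M = "4 * q * k"
  have kM: "k \<le> ?M" using q by simp
  then have M3: "?M \<ge> 3" using k by linarith
  have lnk: "ln (real k) > 0" "ln (real k) \<le> ln (real ?M)"
    using k kM by (auto simp del: of_nat_mult)
  \<comment> \<open>The value z = 1 / ln 2 minimizes z - 1 - ln z / ln 2, and the minimum is
    -c.\<close>
  have z: "1 \<le> 1 / ln (2::real)" "1 / ln (2::real) \<le> 3 / 2" using ln2 by (auto simp: field_simps)
  have "1 / ln 2 - 1 - ln (1 / ln 2) / ln 2 = -c"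
    using ln2 by (simp add: c_def ln_mult ln_div field_simps)
  then have T: "real (card (mult_table ?M)) \<le> 936 * (real ?M)\<^sup>2 * ln (real ?M) powr (-c)"
    using card_mult_table_le[OF z M3] by simp
  \<comment> \<open>ln (k^2) = 2 ln k \<le> 2 ln M, and 2 powr c \<le> 2.\<close>
  have "ln (real ?M) powr (-c) * ln (real (k\<^sup>2)) powr c \<le> 2"
  proof -
    have "ln (real (k\<^sup>2)) powr c \<le> (2 * ln (real ?M)) powr c"
      using lnk k c by (intro powr_mono2) (auto simp: ln_realpow)
    also have "\<dots> = 2 powr c * ln (real ?M) powr c" using lnk by (simp add: powr_mult del: of_nat_mult)
    also have "\<dots> \<le> 2 * ln (real ?M) powr c"
      using powr_mono[of c 1 2] c by (intro mult_right_mono) auto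
    finally show ?thesis using lnk by (simp add: powr_minus field_simps del: of_nat_mult)
  qed
  then have "936 * 16 * (real q)\<^sup>2 * C * (2 * (real q + 2)) *
      (ln (real ?M) powr (-c) * ln (real (k\<^sup>2)) powr c) \<le> 936 * 16 * (real q)\<^sup>2 * C * (2 * (real q + 2)) * 2"
    using C by (intro mult_left_mono) auto
  moreover have "936 * (real ?M)\<^sup>2 * ln (real ?M) powr (-c) * (2 * (real q + 2) * \<delta>) =
      936 * 16 * (real q)\<^sup>2 * C * (2 * (real q + 2)) * (ln (real ?M) powr (-c) * ln (real (k\<^sup>2)) powr c)"
    using k by (simp add: \<delta>_def power_mult_distrib)
  moreover have "real (card (mult_table ?M)) * (2 * (real q + 2) * \<delta>) \<le>
      936 * (real ?M)\<^sup>2 * ln (real ?M) powr (-c) * (2 * (real q + 2) * \<delta>)"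
    using T \<delta> by (intro mult_right_mono) auto
  ultimately have "real (card (mult_table ?M)) * (2 * (real q + 2) * \<delta>) \<le>
      59904 * (real q)\<^sup>2 * (real q + 2) * C"
    by (simp add: algebra_simps)
  then show ?thesis
    using order_trans[OF emeasure_near_rationals_le[OF \<delta>] ennreal_leI] unfolding \<delta>_def by blast
qed

theorem theorem1p3:
  fixes c :: real
  defines "c \<equiv> 1 - ln (exp 1 * ln 2) / ln 2"
  shows "AE \<alpha> in lborel. \<alpha> > 0 \<and> \<alpha> \<notin> \<rat> \<longrightarrow>
           (\<exists>C > 0. infinite {N :: nat. N \<ge> 2 \<and>
              delta_min \<alpha> N \<ge> C * (ln (real N)) powr c / real N})"
proof -
  have c: "c \<le> 1" unfolding c_def by (rule exponent_le_1)
  \<comment> \<open>The constants C = 1 / (j + 1) form a sequence tending to 0.\<close>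
  define \<delta> where "\<delta> j k = 1 / real (Suc j) * ln (real (k\<^sup>2)) powr c / real (k\<^sup>2)" for j k :: nat
  \<comment> \<open>Each q serves the \<alpha> between 1 / (q + 1) and q + 1; these countably many
    ranges exhaust the positive reals.\<close>
  have "AE \<alpha> in lborel. \<exists>j. \<exists>\<^sub>\<infinity>k. \<alpha> \<notin> near_rationals (Suc q) (4 * Suc q * k) (\<delta> j k)" for q
  proof (rule AE_not_eventually_in[where k\<^sub>0 = 3])
    fix j k :: nat assume "k \<ge> 3"
    then show "emeasure lborel (near_rationals (Suc q) (4 * Suc q * k) (\<delta> j k)) \<le>
        ennreal (59904 * (real (Suc q))\<^sup>2 * (real (Suc q) + 2) / real (Suc j))"
      using emeasure_near_rationals_log_le[of "Suc q" k "1 / real (Suc j)"]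
      unfolding \<delta>_def c_def by simp
  qed (rule near_rationals_borel)
  then have "AE \<alpha> in lborel. \<forall>q. \<exists>j. \<exists>\<^sub>\<infinity>k. \<alpha> \<notin> near_rationals (Suc q) (4 * Suc q * k) (\<delta> j k)"
    by (simp add: AE_all_countable)
  then show ?thesis
  proof (eventually_elim, intro impI)
    fix \<alpha> :: real
    assume *: "\<forall>q. \<exists>j. \<exists>\<^sub>\<infinity>k. \<alpha> \<notin> near_rationals (Suc q) (4 * Suc q * k) (\<delta> j k)"
      and \<alpha>: "\<alpha> > 0 \<and> \<alpha> \<notin> \<rat>"
    obtain q where "max \<alpha> (1 / \<alpha>) \<le> real q" using real_arch_simple by blast
    then have "\<alpha> \<le> real (Suc q)" "1 / \<alpha> \<le> real (Suc q)" by auto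
    then have q: "\<alpha> \<le> real (Suc q)" "1 / real (Suc q) \<le> \<alpha>" using \<alpha> by (auto simp: field_simps)
    obtain j where j: "\<exists>\<^sub>\<infinity>k. \<alpha> \<notin> near_rationals (Suc q) (4 * Suc q * k) (\<delta> j k)" using * by blast
    let ?S = "{N :: nat. N \<ge> 2 \<and> delta_min \<alpha> N \<ge> 1 / real (Suc j) * (ln (real N)) powr c / real N}"
    have "\<exists>N\<ge>m. N \<in> ?S" for m
    proof -
      obtain k where k: "k \<ge> max m 3" "\<alpha> \<notin> near_rationals (Suc q) (4 * Suc q * k) (\<delta> j k)"
        using j unfolding INFM_nat_le by blast
      have kk: "k \<le> k\<^sup>2" using k by (simp add: power2_eq_square)
      \<comment> \<open>k \<ge> 3 gives ln (k^2) \<ge> 1, so that c \<le> 1 yields ln (k^2) powr c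
        \<le> k^2 and thereby the condition \<open>\<delta> j k \<le> 1\<close> of
        \<open>delta_min_ge\<close>.\<close>
      have "real 3 \<le> real (k\<^sup>2)" using kk k by (intro of_nat_mono) simp
      then have "exp 1 \<le> real (k\<^sup>2)" using exp_le by simp
      then have ln1: "ln (real (k\<^sup>2)) \<ge> 1" using k by (subst ln_ge_iff) auto
      then have "ln (real (k\<^sup>2)) powr c \<le> ln (real (k\<^sup>2)) powr 1" using c by (intro powr_mono)
      also have "\<dots> \<le> real (k\<^sup>2)" using ln1 ln_le_minus_one[of "real (k\<^sup>2)"] k by simp
      finally have "1 / real (Suc j) * ln (real (k\<^sup>2)) powr c \<le> 1 * real (k\<^sup>2)"
        by (intro mult_mono) auto
      then have "\<delta> j k \<le> 1" using k by (simp add: \<delta>_def divide_le_eq mult.commute)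
      moreover have "\<delta> j k \<ge> 0" by (simp add: \<delta>_def)
      ultimately have "\<delta> j k \<le> delta_min \<alpha> (k\<^sup>2)"
        using \<alpha> q k by (intro delta_min_ge[of \<alpha> "Suc q"]) auto
      then have "k\<^sup>2 \<in> ?S" using k kk by (simp add: \<delta>_def)
      then show ?thesis using k kk by (intro exI[of _ "k\<^sup>2"]) auto
    qed
    then have "infinite ?S" by (simp add: infinite_nat_iff_unbounded_le)
    then show "\<exists>C > 0. infinite {N :: nat. N \<ge> 2 \<and>
              delta_min \<alpha> N \<ge> C * (ln (real N)) powr c / real N}"
      by (intro exI[of _ "1 / real (Suc j)"]) auto
  qed
qed

end
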